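(* Let $E$ be a Banach sequence lattice which has the approximate hyperplane series property (AHSp) and is uniformly monotone. Let $\{X_k:k\in\mathbb{N}\}$ be a sequence of Banach spaces (all real or all complex) that has the approximate hyperplane property (AHp) uniformly. Then the space $\big(\oplus\sum_{k=1}^\infty X_k\big)_E$ has the AHSp.
   Context: For a normed space $X$, $B_X$ and $S_X$ denote its closed unit ball and unit sphere, and $X^*$ its topological dual. A convex series is a series $\sum\alpha_n$ with $0\le\alpha_n\le1$ for each $n$ and $\sum_{n=1}^\infty\alpha_n=1$. A Banach space $X$ has the AHSp if for every $0<\varepsilon<1$ there exists $0<\eta<\varepsilon$ such that for every sequence $\{x_n\}$ in $S_X$ and every convex series $\sum\alpha_n$ with $\big\|\sum_{n=1}^\infty\alpha_nx_n\big\|>1-\eta$, there exist a subset $A\subset\mathbb{N}$ and a subset $\{z_k:k\in A\}\subset S_X$ satisfying: (1) $\sum_{k\in A}\alpha_k>1-\varepsilon$; (2) $\|z_k-x_k\|<\varepsilon$ for all $k\in A$; (3) there is $x^*\in S_{X^*}$ such that $x^*(z_k)=1$ for every $k\in A$. A subset $C\subset S_{X^*}$ is $1$-norming for $X$ if $\|x\|=\sup\{|x^*(x)|:x^*\in C\}$ for every $x\in X$. A Banach space $X$ has the AHp if there exist a function $\delta:(0,1)\to(0,1)$ and a $1$-norming subset $C$ of $S_{X^*}$ such that for every $\varepsilon\in(0,1)$ there is a function $\Upsilon_{X,\varepsilon}:C\to S_{X^*}$ with the following property: if $x^*\in C$, $x\in S_X$ and $\operatorname{Re}x^*(x)>1-\delta(\varepsilon)$,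 then $\operatorname{dist}(x,F(\Upsilon_{X,\varepsilon}(x^* )))<\varepsilon$, where $F(y^* )=\{y\in S_X:\operatorname{Re}y^*(y)=1\}$ for $y^*\in S_{X^*}$. A family $\{X_i:i\in I\}$ of Banach spaces has the AHp uniformly if every $X_i$ has the AHp with the same function $\delta$. Let $\omega$ be the space of all real sequences with the coordinatewise order, and $|x|=(|x_n|)$ for $x=(x_n)\in\omega$. A Banach sequence lattice is a real Banach space $E\subset\omega$ that is solid (if $x\in\omega$, $y\in E$ and $|x|\le|y|$ then $x\in E$ and $\|x\|_E\le\|y\|_E$) and contains some $u\in E$ with $u>0$ (all coordinates strictly positive). $E$ is uniformly monotone if for every $\varepsilon>0$ there is $\delta>0$ such that whenever $x\in S_E$, $y\in E$ and $x,y\ge0$, the condition $\|x+y\|_E\le1+\delta$ implies $\|y\|_E\le\varepsilon$. $\big(\oplus\sum_{k=1}^\infty X_k\big)_E$ is the Banach space of all sequences $x=(x_k)$ with $x_k\in X_k$ for each $k$ and $(\|x_k\|_{X_k})_k\in E$, with norm $\|x\|=\big\|(\|x_k\|_{X_k})_k\big\|_E$. *)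

theory Defs
  imports "HOL-Analysis.Analysis" "HOL-Library.Function_Algebras"
begin

text \<open>
  The scalar field is \<open>\<real>\<close> or \<open>\<complex>\<close>: a type of this class is isometrically isomorphic, as a real
  normed field, to one of the two, and \<open>complex_of_scalar\<close> is the embedding into \<open>\<complex>\<close>.
\<close>

class real_or_complex = real_normed_field +
  fixes complex_of_scalar :: "'a \<Rightarrow> complex"
  assumes complex_of_scalar_add: "complex_of_scalar (x + y) = complex_of_scalar x + complex_of_scalar y"
    and complex_of_scalar_mult: "complex_of_scalar (x * y) = complex_of_scalar x * complex_of_scalar y"
    and complex_of_scalar_scaleR: "complex_of_scalar (r *\<^sub>R x) = r *\<^sub>R complex_of_scalar x"
    and norm_complex_of_scalar: "cmod (complex_of_scalar x) = norm x"
    and range_complex_of_scalar: "range complex_of_scalar = \<real> \<or> range complex_of_scalar = UNIV"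

instantiation real :: real_or_complex
begin

definition complex_of_scalar_real :: "real \<Rightarrow> complex"
  where "complex_of_scalar_real = complex_of_real"

instance
  by standard (auto simp: complex_of_scalar_real_def Reals_def scaleR_conv_of_real)

end

instantiation complex :: real_or_complex
begin

definition complex_of_scalar_complex :: "complex \<Rightarrow> complex"
  where "complex_of_scalar_complex = id"

instance
  by standard (auto simp: complex_of_scalar_complex_def)

end

definition re :: "'k::real_or_complex \<Rightarrow> real"
  where "re c = Re (complex_of_scalar c)"


text \<open>
  A normed space is a linear subspace \<open>carr\<close> of an ambient vector space together with a norm of its
  own, so that spaces in a sequence may differ in underlying set, scalar multiplication and norm
  although they live in one type. Every sequence of normed spaces over the same field arises in this
  way, up to isometric isomorphism, by embedding each term in the algebraic product. The values of
  \<open>nrm\<close> and of functionals outside \<open>carr\<close> are irrelevant.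
\<close>

record ('k, 'v) nspace =
  scal :: "'k \<Rightarrow> 'v \<Rightarrow> 'v"
  carr :: "'v set"
  nrm  :: "'v \<Rightarrow> real"

definition normed_space :: "('k::real_or_complex, 'v::ab_group_add) nspace \<Rightarrow> bool"
  where "normed_space X \<longleftrightarrow>
    vector_space (scal X) \<and> module.subspace (scal X) (carr X) \<and>
    (\<forall>x\<in>carr X. 0 \<le> nrm X x \<and> (nrm X x = 0 \<longleftrightarrow> x = 0)) \<and>
    (\<forall>c. \<forall>x\<in>carr X. nrm X (scal X c x) = norm c * nrm X x) \<and>
    (\<forall>x\<in>carr X. \<forall>y\<in>carr X. nrm X (x + y) \<le> nrm X x + nrm X y)"

definition banach_space :: "('k::real_or_complex, 'v::ab_group_add) nspace \<Rightarrow> bool"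
  where "banach_space X \<longleftrightarrow> normed_space X \<and>
    (\<forall>\<sigma>::nat \<Rightarrow> 'v. range \<sigma> \<subseteq> carr X \<longrightarrow>
      (\<forall>e>0. \<exists>M. \<forall>m\<ge>M. \<forall>n\<ge>M. nrm X (\<sigma> m - \<sigma> n) < e) \<longrightarrow>
      (\<exists>x\<in>carr X. (\<lambda>n. nrm X (\<sigma> n - x)) \<longlonglongrightarrow> 0))"

definition unit_sphere :: "('k, 'v) nspace \<Rightarrow> 'v set"
  where "unit_sphere X = {x \<in> carr X. nrm X x = 1}"

definition unit_ball :: "('k, 'v) nspace \<Rightarrow> 'v set"
  where "unit_ball X = {x \<in> carr X. nrm X x \<le> 1}"

definition dual :: "('k::real_or_complex, 'v::ab_group_add) nspace \<Rightarrow> ('v \<Rightarrow> 'k) set"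
  where "dual X = {f.
    (\<forall>x\<in>carr X. \<forall>y\<in>carr X. f (x + y) = f x + f y) \<and>
    (\<forall>c. \<forall>x\<in>carr X. f (scal X c x) = c * f x) \<and>
    (\<exists>K. \<forall>x\<in>carr X. norm (f x) \<le> K * nrm X x)}"

definition dual_norm :: "('k::real_or_complex, 'v) nspace \<Rightarrow> ('v \<Rightarrow> 'k) \<Rightarrow> real"
  where "dual_norm X f = (SUP x\<in>unit_ball X. norm (f x))"

definition dual_sphere :: "('k::real_or_complex, 'v::ab_group_add) nspace \<Rightarrow> ('v \<Rightarrow> 'k) set"
  where "dual_sphere X = {f \<in> dual X. dual_norm X f = 1}"

definition series_sums :: "('k, 'v::ab_group_add) nspace \<Rightarrow> (nat \<Rightarrow> 'v) \<Rightarrow> 'v \<Rightarrow> bool"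
  where "series_sums X x s \<longleftrightarrow> s \<in> carr X \<and> (\<lambda>n. nrm X ((\<Sum>i<n. x i) - s)) \<longlonglongrightarrow> 0"

definition convex_series :: "(nat \<Rightarrow> real) \<Rightarrow> bool"
  where "convex_series \<alpha> \<longleftrightarrow> (\<forall>n. 0 \<le> \<alpha> n \<and> \<alpha> n \<le> 1) \<and> \<alpha> sums 1"

definition AHSp :: "('k::real_or_complex, 'v::ab_group_add) nspace \<Rightarrow> bool"
  where "AHSp X \<longleftrightarrow> banach_space X \<and>
    (\<forall>\<epsilon>. 0 < \<epsilon> \<and> \<epsilon> < 1 \<longrightarrow>
      (\<exists>\<eta>. 0 < \<eta> \<and> \<eta> < \<epsilon> \<and>
        (\<forall>x \<alpha> s. range x \<subseteq> unit_sphere X \<and> convex_series \<alpha> \<and>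
            series_sums X (\<lambda>n. scal X (of_real (\<alpha> n)) (x n)) s \<and> nrm X s > 1 - \<eta> \<longrightarrow>
          (\<exists>(A::nat set) z. z ` A \<subseteq> unit_sphere X \<and>
            (\<Sum>\<^sub>\<infinity>k\<in>A. \<alpha> k) > 1 - \<epsilon> \<and>
            (\<forall>k\<in>A. nrm X (z k - x k) < \<epsilon>) \<and>
            (\<exists>f\<in>dual_sphere X. \<forall>k\<in>A. f (z k) = 1)))))"

text \<open>
  \<open>C \<noteq> {}\<close> is required because the empty set has no supremum in \<open>\<real>\<close>, while \<open>Sup {}\<close> is an
  unspecified real in HOL. In particular the zero space, whose dual sphere is empty, has no norming set.
\<close>

definition one_norming :: "('k::real_or_complex, 'v::ab_group_add) nspace \<Rightarrow> ('v \<Rightarrow> 'k) set \<Rightarrow> bool"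
  where "one_norming X C \<longleftrightarrow> C \<subseteq> dual_sphere X \<and> C \<noteq> {} \<and>
    (\<forall>x\<in>carr X. nrm X x = (SUP f\<in>C. norm (f x)))"

definition face :: "('k::real_or_complex, 'v) nspace \<Rightarrow> ('v \<Rightarrow> 'k) \<Rightarrow> 'v set"
  where "face X f = {y \<in> unit_sphere X. re (f y) = 1}"

text \<open>The distance is extended real, so that the distance to the empty set is \<open>\<infinity>\<close>.\<close>

definition dist_to :: "('k, 'v::ab_group_add) nspace \<Rightarrow> 'v \<Rightarrow> 'v set \<Rightarrow> ereal"
  where "dist_to X x F = (INF y\<in>F. ereal (nrm X (x - y)))"

definition AHp_with :: "(real \<Rightarrow> real) \<Rightarrow> ('k::real_or_complex, 'v::ab_group_add) nspace \<Rightarrow> bool"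
  where "AHp_with \<delta> X \<longleftrightarrow> banach_space X \<and> \<delta> \<in> {0<..<1} \<rightarrow> {0<..<1} \<and>
    (\<exists>C. one_norming X C \<and>
      (\<forall>\<epsilon>\<in>{0<..<1}. \<exists>\<Upsilon>. \<Upsilon> \<in> C \<rightarrow> dual_sphere X \<and>
        (\<forall>f\<in>C. \<forall>x\<in>unit_sphere X. re (f x) > 1 - \<delta> \<epsilon> \<longrightarrow>
          dist_to X x (face X (\<Upsilon> f)) < ereal \<epsilon>)))"

definition AHp :: "('k::real_or_complex, 'v::ab_group_add) nspace \<Rightarrow> bool"
  where "AHp X \<longleftrightarrow> (\<exists>\<delta>. AHp_with \<delta> X)"

definition AHp_uniformly :: "('i \<Rightarrow> ('k::real_or_complex, 'v::ab_group_add) nspace) \<Rightarrow> bool"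
  where "AHp_uniformly X \<longleftrightarrow> (\<exists>\<delta>. \<forall>i. AHp_with \<delta> (X i))"

definition banach_sequence_lattice :: "(real, nat \<Rightarrow> real) nspace \<Rightarrow> bool"
  where "banach_sequence_lattice E \<longleftrightarrow>
    scal E = (\<lambda>c x n. c * x n) \<and> banach_space E \<and>
    (\<forall>x. \<forall>y\<in>carr E. (\<forall>n. \<bar>x n\<bar> \<le> \<bar>y n\<bar>) \<longrightarrow> x \<in> carr E \<and> nrm E x \<le> nrm E y) \<and>
    (\<exists>u\<in>carr E. \<forall>n. 0 < u n)"

definition uniformly_monotone :: "(real, nat \<Rightarrow> real) nspace \<Rightarrow> bool"
  where "uniformly_monotone E \<longleftrightarrow>
    (\<forall>\<epsilon>>0. \<exists>\<delta>>0. \<forall>x\<in>unit_sphere E. \<forall>y\<in>carr E.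
      (\<forall>n. 0 \<le> x n) \<and> (\<forall>n. 0 \<le> y n) \<and> nrm E (x + y) \<le> 1 + \<delta> \<longrightarrow> nrm E y \<le> \<epsilon>)"

definition E_sum :: "(real, nat \<Rightarrow> real) nspace \<Rightarrow> (nat \<Rightarrow> ('k, 'v) nspace) \<Rightarrow> ('k, nat \<Rightarrow> 'v) nspace"
  where "E_sum E X =
    \<lparr> scal = (\<lambda>c x k. scal (X k) c (x k)),
      carr = {x. (\<forall>k. x k \<in> carr (X k)) \<and> (\<lambda>k. nrm (X k) (x k)) \<in> carr E},
      nrm = (\<lambda>x. nrm E (\<lambda>k. nrm (X k) (x k))) \<rparr>"

end

theory Submission imports Defs begin

text \<open>
  Let \<open>\<Sum> \<alpha>\<^sub>n x\<^sub>n = s\<close> be a convex series of unit vectors with norm near 1, and pass to the norm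
  sequences \<open>a\<^sub>n = (\<parallel>x\<^sub>n(k)\<parallel>)\<^sub>k\<close> in \<open>E\<close>. The AHSp of \<open>E\<close> gives nearby nonnegative \<open>b\<^sub>n\<close> and a norming
  functional, which by order continuity of the norm is a sequence of weights \<open>g\<^sub>k \<ge> 0\<close>. Uniform monotonicity
  forces \<open>\<Sum> \<alpha>\<^sub>n a\<^sub>n\<close> to be close to \<open>(\<parallel>s(k)\<parallel>)\<^sub>k\<close>. Hence, if \<open>h\<^sub>k\<close> in the norming set of \<open>X\<^sub>k\<close> almost
  attains its norm at \<open>s(k)\<close>, the defects \<open>\<Sum>\<^sub>k g\<^sub>k (\<parallel>x\<^sub>n(k)\<parallel> - Re h\<^sub>k(x\<^sub>n(k)))\<close> have a small average with respect
  to \<open>\<alpha>\<close>, so by Markov's inequality most of them are small. For such \<open>n\<close> the vector \<open>x\<^sub>n\<close> is corrected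
  coordinatewise to \<open>z\<^sub>n(k) = b\<^sub>n(k) y\<^sub>n(k)\<close>, where \<open>y\<^sub>n(k)\<close> lies in the face of a functional \<open>p\<^sub>k\<close> given by the AHp,
  and \<open>\<Sum>\<^sub>k g\<^sub>k p\<^sub>k\<close> is the required functional.
\<close>

subsection \<open>Scalars\<close>

lemma complex_of_scalar_0 [simp]: "complex_of_scalar 0 = 0"
  using norm_complex_of_scalar[of 0] by simp

lemma complex_of_scalar_minus: "complex_of_scalar (- x) = - complex_of_scalar x"
  using complex_of_scalar_add[of x "- x"] by (simp add: add_eq_0_iff)

lemma complex_of_scalar_diff: "complex_of_scalar (x - y) = complex_of_scalar x - complex_of_scalar y"
  using complex_of_scalar_add[of x "- y"] by (simp add: complex_of_scalar_minus)

lemma complex_of_scalar_sum: "complex_of_scalar (sum f A) = (\<Sum>i\<in>A. complex_of_scalar (f i))"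
  by (induction A rule: infinite_finite_induct) (simp_all add: complex_of_scalar_add)

lemma complex_of_scalar_1 [simp]: "complex_of_scalar (1::'k::real_or_complex) = 1"
proof -
  have "complex_of_scalar (1::'k) * complex_of_scalar (1::'k) = complex_of_scalar (1::'k)"
    using complex_of_scalar_mult[of 1 "1::'k"] by simp
  moreover have "complex_of_scalar (1::'k) \<noteq> 0"
    using norm_complex_of_scalar[of "1::'k"] by auto
  ultimately show ?thesis by simp
qed

lemma complex_of_scalar_of_real [simp]: "complex_of_scalar (of_real r) = of_real r"
  using complex_of_scalar_scaleR[of r 1] by (simp add: of_real_def)

lemma re_add: "re (x + y) = re x + re y"
  by (simp add: re_def complex_of_scalar_add)

lemma re_of_real_mult: "re (of_real r * x) = r * re x"
  by (simp add: re_def complex_of_scalar_mult)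

lemma re_of_real [simp]: "re (of_real r) = r"
  by (simp add: re_def)

lemma abs_re_le_norm: "\<bar>re x\<bar> \<le> norm x"
  by (metis re_def abs_Re_le_cmod norm_complex_of_scalar)

lemma re_le_norm: "re x \<le> norm x"
  using abs_re_le_norm[of x] by simp

text \<open>The norm bound leaves no room for an imaginary part. This turns membership in
  \<open>face\<close>, which only speaks of real parts, into the equation with value 1 that the AHSp
  demands.\<close>

lemma re_eq_1_imp_eq_1:
  fixes x :: "'k::real_or_complex"
  assumes "re x = 1" "norm x \<le> 1"
  shows "x = 1"
proof -
  have "(Re (complex_of_scalar x))\<^sup>2 + (Im (complex_of_scalar x))\<^sup>2 \<le> 1"
    by (metis assms(2) cmod_power2 norm_complex_of_scalar norm_ge_zero power_le_one)
  then have "complex_of_scalar x = 1"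
    using assms(1) by (simp add: re_def complex_eq_iff)
  then have "norm (x - 1) = 0"
    by (metis cancel_comm_monoid_add_class.diff_cancel complex_of_scalar_1 complex_of_scalar_diff
        norm_complex_of_scalar norm_zero)
  then show ?thesis by simp
qed

text \<open>Completeness is not among the axioms of the scalar class. The series is therefore summed
  in the complex numbers, and its limit comes back because the range of the embedding is closed,
  being either the reals or everything.\<close>

lemma summable_scalar:
  fixes f :: "nat \<Rightarrow> 'k::real_or_complex"
  assumes "summable (\<lambda>n. norm (f n))"
  shows "summable f"
proof -
  define S where "S n = (\<Sum>i<n. f i)" for n
  have "summable (\<lambda>n. complex_of_scalar (f n))"
    by (rule summable_norm_cancel) (simp add: norm_complex_of_scalar assms)
  then obtain c where "(\<lambda>n. complex_of_scalar (f n)) sums c"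
    by (auto simp: summable_def)
  then have c: "(\<lambda>n. complex_of_scalar (S n)) \<longlonglongrightarrow> c"
    by (simp add: sums_def S_def complex_of_scalar_sum)
  have "closed (range (complex_of_scalar :: 'k \<Rightarrow> complex))"
    using range_complex_of_scalar[where 'a='k] closed_complex_Reals by auto
  then have "c \<in> range (complex_of_scalar :: 'k \<Rightarrow> complex)"
    using closed_sequentially[of _ "\<lambda>n. complex_of_scalar (S n)" c] c by blast
  then obtain w where w: "c = complex_of_scalar (w::'k)" by auto
  have "(\<lambda>n. cmod (complex_of_scalar (S n - w))) \<longlonglongrightarrow> 0"
    unfolding complex_of_scalar_diff using c w by (intro tendsto_norm_zero LIM_zero) simp
  then have "(\<lambda>n. norm (S n - w)) \<longlonglongrightarrow> 0"
    by (simp only: norm_complex_of_scalar)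
  then have "S \<longlonglongrightarrow> w"
    by (rule LIM_zero_cancel[OF tendsto_norm_zero_cancel])
  then show ?thesis
    unfolding S_def summable_def sums_def by blast
qed

subsection \<open>Normed spaces\<close>

lemma scal_algebra:
  assumes "normed_space X"
  shows scal_add_right: "scal X c (x + y) = scal X c x + scal X c y"
    and scal_add_left: "scal X (c + d) x = scal X c x + scal X d x"
    and scal_diff_right: "scal X c (x - y) = scal X c x - scal X c y"
    and scal_diff_left: "scal X (c - d) x = scal X c x - scal X d x"
    and scal_scal: "scal X c (scal X d x) = scal X (c * d) x"
    and scal_one: "scal X 1 x = x"
    and scal_minus_one: "scal X (- 1) x = - x"
proof -
  interpret vector_space "scal X" using assms by (simp add: normed_space_def)
  show "scal X c (x + y) = scal X c x + scal X c y" "scal X (c + d) x = scal X c x + scal X d x"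
    "scal X c (x - y) = scal X c x - scal X c y" "scal X (c - d) x = scal X c x - scal X d x"
    "scal X c (scal X d x) = scal X (c * d) x" "scal X 1 x = x" "scal X (- 1) x = - x"
    by (simp_all add: algebra_simps)
qed

lemma carr_closed:
  assumes "normed_space X"
  shows zero_carr: "0 \<in> carr X"
    and add_carr: "x \<in> carr X \<Longrightarrow> y \<in> carr X \<Longrightarrow> x + y \<in> carr X"
    and diff_carr: "x \<in> carr X \<Longrightarrow> y \<in> carr X \<Longrightarrow> x - y \<in> carr X"
    and scal_carr: "x \<in> carr X \<Longrightarrow> scal X c x \<in> carr X"
    and sum_carr: "(\<And>i. i \<in> A \<Longrightarrow> z i \<in> carr X) \<Longrightarrow> sum z A \<in> carr X"
proof -
  interpret vector_space "scal X" using assms by (simp add: normed_space_def)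
  have s: "subspace (carr X)" using assms by (simp add: normed_space_def)
  show "0 \<in> carr X" "x \<in> carr X \<Longrightarrow> y \<in> carr X \<Longrightarrow> x + y \<in> carr X"
    "x \<in> carr X \<Longrightarrow> y \<in> carr X \<Longrightarrow> x - y \<in> carr X" "x \<in> carr X \<Longrightarrow> scal X c x \<in> carr X"
    "(\<And>i. i \<in> A \<Longrightarrow> z i \<in> carr X) \<Longrightarrow> sum z A \<in> carr X"
    using s by (auto intro: subspace_0 subspace_add subspace_diff subspace_scale subspace_sum)
qed

lemma nrm_basic:
  assumes "normed_space X"
  shows nrm_nonneg: "x \<in> carr X \<Longrightarrow> 0 \<le> nrm X x"
    and nrm_eq_0_iff: "x \<in> carr X \<Longrightarrow> nrm X x = 0 \<longleftrightarrow> x = 0"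
    and nrm_zero: "nrm X 0 = 0"
    and nrm_scal: "x \<in> carr X \<Longrightarrow> nrm X (scal X c x) = norm c * nrm X x"
    and nrm_triangle: "x \<in> carr X \<Longrightarrow> y \<in> carr X \<Longrightarrow> nrm X (x + y) \<le> nrm X x + nrm X y"
  using assms zero_carr[OF assms] by (auto simp: normed_space_def)

lemma nrm_minus_commute:
  assumes "normed_space X" "x \<in> carr X" "y \<in> carr X"
  shows "nrm X (x - y) = nrm X (y - x)"
  using nrm_scal[OF assms(1) diff_carr[OF assms], of "-1"] scal_minus_one[OF assms(1), of "x - y"]
  by simp

lemma nrm_triangle_diff:
  assumes "normed_space X" "x \<in> carr X" "y \<in> carr X" "z \<in> carr X"
  shows "nrm X (x - z) \<le> nrm X (x - y) + nrm X (y - z)"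
  using nrm_triangle[OF assms(1) diff_carr[OF assms(1-3)] diff_carr[OF assms(1,3,4)]] by simp

lemma abs_nrm_diff_le:
  assumes "normed_space X" "x \<in> carr X" "y \<in> carr X"
  shows "\<bar>nrm X x - nrm X y\<bar> \<le> nrm X (x - y)"
  using nrm_triangle_diff[OF assms(1,2,3) zero_carr[OF assms(1)]]
    nrm_triangle_diff[OF assms(1,3,2) zero_carr[OF assms(1)]] nrm_minus_commute[OF assms]
  by simp

lemma nrm_diff_le:
  assumes "normed_space X" "x \<in> carr X" "y \<in> carr X"
  shows "nrm X (x - y) \<le> nrm X x + nrm X y"
  using nrm_triangle_diff[OF assms(1,2) zero_carr[OF assms(1)] assms(3)]
    nrm_minus_commute[OF assms(1,3) zero_carr[OF assms(1)]] by simp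

lemma nrm_sum_le:
  assumes "normed_space X" "\<And>i. i \<in> A \<Longrightarrow> z i \<in> carr X"
  shows "nrm X (sum z A) \<le> (\<Sum>i\<in>A. nrm X (z i))"
  using assms(2)
proof (induction A rule: infinite_finite_induct)
  case (insert a A)
  have "nrm X (z a + sum z A) \<le> nrm X (z a) + nrm X (sum z A)"
    using insert by (intro nrm_triangle[OF assms(1)] sum_carr[OF assms(1)]) auto
  with insert show ?case by fastforce
qed (simp_all add: nrm_zero[OF assms(1)])

lemma tendsto_nrm:
  assumes X: "normed_space X" and "\<And>n. x n \<in> carr X" "y \<in> carr X"
    and lim: "(\<lambda>n. nrm X (x n - y)) \<longlonglongrightarrow> 0"
  shows "(\<lambda>n. nrm X (x n)) \<longlonglongrightarrow> nrm X y"
proof -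
  have "(\<lambda>n. nrm X (x n) - nrm X y) \<longlonglongrightarrow> 0"
    by (rule tendsto_rabs_zero_cancel, rule tendsto_sandwich[OF _ _ tendsto_const lim])
      (auto intro!: always_eventually abs_nrm_diff_le assms)
  then show ?thesis by (simp add: LIM_zero_iff)
qed

section \<open>Bounded functionals and the dual sphere\<close>

lemma dual_linear:
  assumes "normed_space X" "f \<in> dual X"
  shows dual_add: "x \<in> carr X \<Longrightarrow> y \<in> carr X \<Longrightarrow> f (x + y) = f x + f y"
    and dual_scal: "x \<in> carr X \<Longrightarrow> f (scal X c x) = c * f x"
    and dual_zero: "f 0 = 0"
    and dual_diff: "x \<in> carr X \<Longrightarrow> y \<in> carr X \<Longrightarrow> f (x - y) = f x - f y"
proof -
  show 1: "x \<in> carr X \<Longrightarrow> y \<in> carr X \<Longrightarrow> f (x + y) = f x + f y" for x y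
    using assms(2) by (auto simp: dual_def)
  show "x \<in> carr X \<Longrightarrow> f (scal X c x) = c * f x"
    using assms(2) by (auto simp: dual_def)
  show "f 0 = 0"
    using 1[of 0 0] zero_carr[OF assms(1)] by simp
  show "x \<in> carr X \<Longrightarrow> y \<in> carr X \<Longrightarrow> f (x - y) = f x - f y"
    using 1[of "x - y" y] diff_carr[OF assms(1)] by simp
qed

lemma dual_sum:
  assumes "normed_space X" "f \<in> dual X" "\<And>i. i \<in> A \<Longrightarrow> z i \<in> carr X"
  shows "f (sum z A) = (\<Sum>i\<in>A. f (z i))"
  using assms(3)
proof (induction A rule: infinite_finite_induct)
  case (insert a A)
  have "f (z a + sum z A) = f (z a) + f (sum z A)"
    using insert by (intro dual_add[OF assms(1,2)] sum_carr[OF assms(1)]) auto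
  with insert show ?case by simp
qed (simp_all add: dual_zero[OF assms(1,2)])

lemma dual_sphere_bound:
  assumes X: "normed_space X" and f: "f \<in> dual_sphere X" and x: "x \<in> carr X"
  shows "norm (f x) \<le> nrm X x"
proof (cases "x = 0")
  case True
  have "f \<in> dual X" using f by (simp add: dual_sphere_def)
  then show ?thesis using True dual_zero[OF X] nrm_zero[OF X] by simp
next
  case False
  have fd: "f \<in> dual X" and f1: "dual_norm X f = 1" using f by (auto simp: dual_sphere_def)
  define r where "r = nrm X x"
  have r: "r > 0" using False nrm_nonneg[OF X x] nrm_eq_0_iff[OF X x] by (simp add: r_def)
  obtain K where K: "\<And>x. x \<in> carr X \<Longrightarrow> norm (f x) \<le> K * nrm X x"
    using fd unfolding dual_def by blast
  \<comment> \<open>A real \<open>SUP\<close> is an upper bound only for a bounded set, so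
    boundedness on the unit ball has to be established before \<open>dual_norm\<close> can be
    used.\<close>
  have "norm (f y) \<le> \<bar>K\<bar>" if "y \<in> unit_ball X" for y
  proof -
    have y: "y \<in> carr X" "nrm X y \<le> 1" using that by (auto simp: unit_ball_def)
    have "K * nrm X y \<le> \<bar>K\<bar> * 1"
      using y nrm_nonneg[OF X y(1)] by (intro mult_mono) auto
    with K[OF y(1)] show ?thesis by simp
  qed
  then have "bdd_above ((\<lambda>x. norm (f x)) ` unit_ball X)" by (auto intro!: bdd_aboveI2)
  moreover have "scal X (of_real (1/r)) x \<in> unit_ball X"
    using r x by (simp add: unit_ball_def scal_carr[OF X] nrm_scal[OF X] norm_divide r_def)
  ultimately have "norm (f (scal X (of_real (1/r)) x)) \<le> dual_norm X f"
    unfolding dual_norm_def by (rule cSUP_upper[rotated])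
  then have "norm (f x) / r \<le> 1"
    using f1 r by (simp add: dual_scal[OF X fd x] norm_mult norm_divide)
  then show ?thesis using r by (simp add: r_def divide_le_eq)
qed

text \<open>Contractivity bounds the dual norm by 1, and the point \<open>z\<close> shows that the
  value 1 is attained.\<close>

lemma dual_sphereI:
  assumes X: "normed_space X" and "f \<in> dual X" "\<And>x. x \<in> carr X \<Longrightarrow> norm (f x) \<le> nrm X x"
    and "z \<in> unit_sphere X" "f z = 1"
  shows "f \<in> dual_sphere X"
proof -
  have le: "norm (f x) \<le> 1" if "x \<in> unit_ball X" for x
    using that assms(3)[of x] by (auto simp: unit_ball_def)
  have z: "z \<in> unit_ball X" using assms(4) by (auto simp: unit_sphere_def unit_ball_def)
  have "dual_norm X f \<le> 1"
    unfolding dual_norm_def using z le by (intro cSUP_least) auto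
  moreover have "norm (f z) \<le> dual_norm X f"
    unfolding dual_norm_def using z le by (intro cSUP_upper bdd_aboveI2) auto
  ultimately show ?thesis using assms(2,5) by (simp add: dual_sphere_def)
qed

lemma dual_sphere_almost_attained:
  assumes X: "normed_space X" and f: "f \<in> dual_sphere X" and "d > 0"
  obtains x where "x \<in> unit_sphere X" "re (f x) > 1 - d"
proof -
  have fd: "f \<in> dual X" and f1: "(SUP x\<in>unit_ball X. norm (f x)) = 1"
    using f by (auto simp: dual_sphere_def dual_norm_def)
  have ne: "unit_ball X \<noteq> {}"
    using zero_carr[OF X] nrm_zero[OF X] by (auto simp: unit_ball_def intro!: exI[of _ 0])
  \<comment> \<open>The maximum with 0 guarantees \<open>f y\<close> to be nonzero even when
    \<open>d\<close> is larger than 1.\<close>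
  have "max 0 (1 - d) < (SUP x\<in>unit_ball X. norm (f x))" using f1 assms(3) by simp
  then obtain y where y: "y \<in> unit_ball X" "max 0 (1 - d) < norm (f y)"
    using less_cSupD[of "(\<lambda>x. norm (f x)) ` unit_ball X"] ne by blast
  have yc: "y \<in> carr X" and y1: "nrm X y \<le> 1" using y by (auto simp: unit_ball_def)
  define r where "r = nrm X y"
  have "y \<noteq> 0" using y dual_zero[OF X fd] by auto
  then have r: "r > 0" "r \<le> 1" using y1 nrm_nonneg[OF X yc] nrm_eq_0_iff[OF X yc] by (auto simp: r_def)
  \<comment> \<open>The factor removes the phase of \<open>f y\<close> and moves \<open>y\<close> to
    the sphere. Since \<open>r\<close> is at most 1, the resulting real value is no smaller than
    \<open>norm (f y)\<close>.\<close>
  define c where "c = of_real (norm (f y) / r) / f y"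
  have fy: "norm (f y) > 0" using y by simp
  have "scal X c y \<in> unit_sphere X"
    using fy r by (simp add: unit_sphere_def scal_carr[OF X yc] nrm_scal[OF X yc] c_def norm_divide norm_mult r_def)
  moreover have "f (scal X c y) = of_real (norm (f y) / r)"
    using fy by (simp add: dual_scal[OF X fd yc] c_def)
  then have "re (f (scal X c y)) = norm (f y) / r"
    by (simp only: re_of_real)
  moreover have "norm (f y) \<le> norm (f y) / r" using fy r by (simp add: le_divide_eq mult_left_le)
  ultimately show ?thesis using that[of "scal X c y"] y by simp
qed

subsection \<open>Banach sequence lattices\<close>

definition restr :: "nat set \<Rightarrow> (nat \<Rightarrow> real) \<Rightarrow> nat \<Rightarrow> real"
  where "restr K x = (\<lambda>n. if n \<in> K then x n else 0)"

lemma lattice_normed_space: "banach_sequence_lattice E \<Longrightarrow> normed_space E"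
  by (simp add: banach_sequence_lattice_def banach_space_def)

lemma lattice_scal: "banach_sequence_lattice E \<Longrightarrow> scal E c x = (\<lambda>n. c * x n)"
  by (simp add: banach_sequence_lattice_def)

lemma lattice_solid:
  assumes "banach_sequence_lattice E" "y \<in> carr E" "\<And>n. \<bar>x n\<bar> \<le> \<bar>y n\<bar>"
  shows "x \<in> carr E" "nrm E x \<le> nrm E y"
  using assms unfolding banach_sequence_lattice_def by blast+

lemma lattice_abs:
  assumes "banach_sequence_lattice E" "x \<in> carr E"
  shows "(\<lambda>n. \<bar>x n\<bar>) \<in> carr E" "nrm E (\<lambda>n. \<bar>x n\<bar>) = nrm E x"
proof -
  show "(\<lambda>n. \<bar>x n\<bar>) \<in> carr E" by (rule lattice_solid[OF assms]) simp
  then show "nrm E (\<lambda>n. \<bar>x n\<bar>) = nrm E x"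
    by (intro antisym lattice_solid(2)[OF assms(1)] assms(2)) auto
qed

lemma lattice_restr:
  assumes "banach_sequence_lattice E" "x \<in> carr E"
  shows "restr K x \<in> carr E" "nrm E (restr K x) \<le> nrm E x"
  by (rule lattice_solid[OF assms], simp add: restr_def)+

text \<open>On a finite set the strictly positive element \<open>u\<close> dominates every sequence
  up to a constant, so solidity applies. In particular the unit vectors belong to
  \<open>E\<close>.\<close>

lemma lattice_restr_finite:
  assumes E: "banach_sequence_lattice E" and "finite K"
  shows "restr K x \<in> carr E"
proof -
  obtain u where u: "u \<in> carr E" "\<And>n. 0 < u n"
    using E unfolding banach_sequence_lattice_def by blast
  define C where "C = (\<Sum>i\<in>K. \<bar>x i\<bar> / u i)"
  have nonneg: "0 \<le> \<bar>x i\<bar> / u i" for i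
    using u(2)[of i] by simp
  have "\<bar>restr K x n\<bar> \<le> \<bar>C * u n\<bar>" for n
  proof (cases "n \<in> K")
    case True
    have "\<bar>x n\<bar> / u n \<le> C"
      unfolding C_def using True assms(2) nonneg by (intro member_le_sum) auto
    then show ?thesis
      using True u(2)[of n] by (simp add: restr_def divide_le_eq abs_mult)
        (meson abs_ge_self dual_order.trans mult_right_mono less_imp_le)
  qed (simp add: restr_def)
  moreover have "(\<lambda>n. C * u n) \<in> carr E"
    using scal_carr[OF lattice_normed_space[OF E] u(1), of C] by (simp add: lattice_scal[OF E])
  ultimately show ?thesis
    using lattice_solid(1)[OF E, of "\<lambda>n. C * u n"] by blast
qed

text \<open>By solidity, \<open>x k\<close> times the unit vector at \<open>k\<close> has norm at
  most that of \<open>x\<close>; the constant is the reciprocal of the norm of this unit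
  vector.\<close>

lemma lattice_coordinate_bound:
  assumes E: "banach_sequence_lattice E"
  obtains C where "C > 0" "\<And>x. x \<in> carr E \<Longrightarrow> \<bar>x k\<bar> \<le> C * nrm E x"
proof -
  note NE = lattice_normed_space[OF E]
  define e where "e = restr {k} (\<lambda>_. 1)"
  have e: "e \<in> carr E" unfolding e_def by (rule lattice_restr_finite[OF E]) simp
  have "e k \<noteq> 0" by (simp add: e_def restr_def)
  then have "e \<noteq> 0" by auto
  then have pos: "nrm E e > 0"
    using nrm_nonneg[OF NE e] nrm_eq_0_iff[OF NE e] by simp
  show thesis
  proof (rule that[of "1 / nrm E e"])
    show "1 / nrm E e > 0" using pos by simp
    fix x assume x: "x \<in> carr E"
    have "nrm E (scal E (x k) e) \<le> nrm E x"
      by (rule lattice_solid(2)[OF E x]) (simp add: lattice_scal[OF E] e_def restr_def)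
    then show "\<bar>x k\<bar> \<le> 1 / nrm E e * nrm E x"
      using pos by (simp add: nrm_scal[OF NE e] field_simps)
  qed
qed

lemma lattice_tendsto_coordinate:
  assumes E: "banach_sequence_lattice E" and x: "\<And>n. x n \<in> carr E" and y: "y \<in> carr E"
    and lim: "(\<lambda>n. nrm E (x n - y)) \<longlonglongrightarrow> 0"
  shows "(\<lambda>n. x n k) \<longlonglongrightarrow> y k"
proof -
  obtain C where C: "\<And>x. x \<in> carr E \<Longrightarrow> \<bar>x k\<bar> \<le> C * nrm E x"
    using lattice_coordinate_bound[OF E] by blast
  have "(\<lambda>n. C * nrm E (x n - y)) \<longlonglongrightarrow> 0"
    using tendsto_mult_right_zero[OF lim] .
  moreover have "\<bar>x n k - y k\<bar> \<le> C * nrm E (x n - y)" for n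
    using C[OF diff_carr[OF lattice_normed_space[OF E] x y]] by simp
  ultimately have "(\<lambda>n. x n k - y k) \<longlonglongrightarrow> 0"
    by (intro Lim_null_comparison[of "\<lambda>n. x n k - y k"]) auto
  then show ?thesis by (simp add: LIM_zero_iff)
qed

section \<open>Completeness, order continuity and the functionals of the lattice\<close>

lemma banach_space_complete:
  assumes "banach_space X" "\<And>n. \<sigma> n \<in> carr X"
    and "\<And>e. e > 0 \<Longrightarrow> \<exists>M. \<forall>m\<ge>M. \<forall>n\<ge>M. nrm X (\<sigma> m - \<sigma> n) < e"
  obtains x where "x \<in> carr X" "(\<lambda>n. nrm X (\<sigma> n - x)) \<longlonglongrightarrow> 0"
proof -
  have "range \<sigma> \<subseteq> carr X" using assms(2) by blast
  with assms(1,3) have "\<exists>x\<in>carr X. (\<lambda>n. nrm X (\<sigma> n - x)) \<longlonglongrightarrow> 0"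
    unfolding banach_space_def by simp
  with that show thesis by blast
qed

text \<open>Homogeneity frees uniform monotonicity from the normalisation of \<open>x\<close>: a
  bound \<open>R\<close> for the norm of the sum is prescribed, and \<open>x\<close> only has to
  come close to it. This suits situations where the larger vector is the one under control.\<close>

lemma uniformly_monotone_scaled:
  assumes E: "banach_sequence_lattice E" and um: "uniformly_monotone E" and "\<epsilon> > 0"
  obtains \<delta> where "0 < \<delta>" "\<delta> < 1"
    "\<And>x y R. \<lbrakk>x \<in> carr E; y \<in> carr E; \<And>n. 0 \<le> x n; \<And>n. 0 \<le> y n; 0 < R;
      nrm E (x + y) \<le> R; (1 - \<delta>) * R \<le> nrm E x\<rbrakk> \<Longrightarrow> nrm E y \<le> \<epsilon> * R"
proof -
  note NE = lattice_normed_space[OF E]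
  obtain d where d: "d > 0" and um': "\<And>x y. \<lbrakk>x \<in> unit_sphere E; y \<in> carr E; \<And>n. 0 \<le> x n;
      \<And>n. 0 \<le> y n; nrm E (x + y) \<le> 1 + d\<rbrakk> \<Longrightarrow> nrm E y \<le> \<epsilon>"
    using um assms(3) unfolding uniformly_monotone_def by metis
  have eq: "1 - d / (1 + d) = 1 / (1 + d)" using d by (simp add: field_simps)
  show thesis
  \<comment> \<open>With this value the norm of \<open>x\<close> is at least
    \<open>R / (1 + d)\<close>, so after division by it the sum has norm at most
    \<open>1 + d\<close>, as the original condition requires.\<close>
  proof (rule that[of "d / (1 + d)"])
    show "0 < d / (1 + d)" "d / (1 + d) < 1" using d by auto
    fix x y :: "nat \<Rightarrow> real" and R :: real
    assume x: "x \<in> carr E" and y: "y \<in> carr E" and x0: "\<And>n. 0 \<le> x n" and y0: "\<And>n. 0 \<le> y n"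
      and R: "0 < R" and le: "nrm E (x + y) \<le> R" and ge: "(1 - d / (1 + d)) * R \<le> nrm E x"
    define c where "c = nrm E x"
    have Rc: "R \<le> (1 + d) * c" using ge d unfolding eq c_def by (simp add: field_simps)
    have c: "c > 0" using ge R d unfolding eq c_def
      by (smt (verit) divide_pos_pos mult_pos_pos)
    have cR: "c \<le> R"
    proof -
      have "nrm E x \<le> nrm E (x + y)"
        using x0 y0 by (intro lattice_solid(2)[OF E add_carr[OF NE x y]]) (simp add: add_nonneg_nonneg)
      with le show ?thesis by (simp add: c_def)
    qed
    have "nrm E (scal E (1/c) y) \<le> \<epsilon>"
    proof (rule um')
      show "scal E (1/c) x \<in> unit_sphere E"
        using c by (simp add: unit_sphere_def scal_carr[OF NE x] nrm_scal[OF NE x] c_def)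
      show "scal E (1/c) y \<in> carr E" by (rule scal_carr[OF NE y])
      show "0 \<le> scal E (1/c) x n" "0 \<le> scal E (1/c) y n" for n
        using c x0 y0 by (simp_all add: lattice_scal[OF E])
      have "nrm E (scal E (1/c) x + scal E (1/c) y) = nrm E (x + y) / c"
        using c nrm_scal[OF NE add_carr[OF NE x y], of "1/c"] by (simp add: scal_add_right[OF NE])
      also have "\<dots> \<le> 1 + d" using le Rc c by (simp add: divide_le_eq)
      finally show "nrm E (scal E (1/c) x + scal E (1/c) y) \<le> 1 + d" .
    qed
    then have "nrm E y \<le> \<epsilon> * c" using c by (simp add: nrm_scal[OF NE y] divide_le_eq)
    also have "\<dots> \<le> \<epsilon> * R" using cR assms(3) by simp
    finally show "nrm E y \<le> \<epsilon> * R" .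
  qed
qed

text \<open>Uniform monotonicity makes the norm order continuous: the norms of the truncations increase to
  a limit, so the differences of late truncations have small norm.\<close>

lemma uniformly_monotone_truncation:
  assumes E: "banach_sequence_lattice E" and um: "uniformly_monotone E" and x: "x \<in> carr E"
  shows "(\<lambda>N. nrm E (restr {..<N} x - x)) \<longlonglongrightarrow> 0"
proof -
  note NE = lattice_normed_space[OF E]
  have B: "banach_space E" using E by (simp add: banach_sequence_lattice_def)
  define r where "r N = restr {..<N} x" for N
  have r: "r N \<in> carr E" "nrm E (r N) \<le> nrm E x" for N
    unfolding r_def by (rule lattice_restr[OF E x])+
  have "mono (\<lambda>N. nrm E (r N))"
    by (intro monoI lattice_solid(2)[OF E r(1)]) (auto simp: r_def restr_def)
  then have inc: "incseq (\<lambda>N. nrm E (r N))" by simp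
  then obtain L where lim: "(\<lambda>N. nrm E (r N)) \<longlonglongrightarrow> L" and L: "\<And>N. nrm E (r N) \<le> L"
    using incseq_convergent[of "\<lambda>N. nrm E (r N)" "nrm E x"] r(2) by auto
  have L0: "L \<ge> 0" using L[of 0] nrm_nonneg[OF NE r(1), of 0] by simp
  have cauchy: "\<exists>M. \<forall>m\<ge>M. \<forall>n\<ge>M. nrm E (r m - r n) < e" if e: "e > 0" for e
  \<comment> \<open>The limit \<open>L\<close> serves as the bound \<open>R\<close> and as a divisor
    below; if it is 0, all truncations vanish.\<close>
  proof (cases "L = 0")
    case True
    then have "r N = 0" for N
      using L[of N] nrm_nonneg[OF NE r(1), of N] nrm_eq_0_iff[OF NE r(1), of N] by simp
    then show ?thesis using e by (simp add: nrm_zero[OF NE])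
  next
    case False
    then have Lpos: "L > 0" using L0 by simp
    \<comment> \<open>With \<open>R = L\<close> the parameter \<open>e / (3 * L)\<close> becomes the
      bound \<open>e / 3\<close>, and two such distances to \<open>r M\<close> stay below
      \<open>e\<close>.\<close>
    obtain d where d: "0 < d" "d < 1" and um': "\<And>x y R. \<lbrakk>x \<in> carr E; y \<in> carr E; \<And>n. 0 \<le> x n;
        \<And>n. 0 \<le> y n; 0 < R; nrm E (x + y) \<le> R; (1 - d) * R \<le> nrm E x\<rbrakk> \<Longrightarrow> nrm E y \<le> e / (3 * L) * R"
      using uniformly_monotone_scaled[OF E um, of "e / (3 * L)"] e Lpos by auto
    have "(1 - d) * L < L" using d Lpos by simp
    then have "\<forall>\<^sub>F N in sequentially. (1 - d) * L < nrm E (r N)"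
      using lim by (simp add: order_tendstoD)
    then obtain M where M: "(1 - d) * L < nrm E (r M)"
      by (auto simp: eventually_sequentially)
    have near: "nrm E (r m - r M) \<le> e / 3" if m: "m \<ge> M" for m
    proof -
      \<comment> \<open>The truncation \<open>r M\<close> and the increment \<open>r m - r M\<close>
        have disjoint supports, so their absolute values add up to that of \<open>r m\<close>, whose
        norm is at most \<open>L\<close>.\<close>
      define p q where "p = (\<lambda>n. \<bar>r M n\<bar>)" and "q = (\<lambda>n. \<bar>(r m - r M) n\<bar>)"
      have p: "p \<in> carr E" "nrm E p = nrm E (r M)"
        unfolding p_def using lattice_abs[OF E r(1)] by auto
      have q: "q \<in> carr E" "nrm E q = nrm E (r m - r M)"
        unfolding q_def using lattice_abs[OF E diff_carr[OF NE r(1) r(1)]] by auto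
      have "p + q = (\<lambda>n. \<bar>r m n\<bar>)"
        using m by (auto simp: p_def q_def r_def restr_def fun_eq_iff)
      then have "nrm E (p + q) \<le> L" using lattice_abs(2)[OF E r(1)] L by simp
      then have "nrm E q \<le> e / (3 * L) * L"
        using M p Lpos q(1) by (intro um'[of p]) (auto simp: p_def q_def)
      then show ?thesis using q(2) Lpos by simp
    qed
    have "nrm E (r m - r n) < e" if mn: "m \<ge> M" "n \<ge> M" for m n
      using nrm_triangle_diff[OF NE r(1)[of m] r(1)[of M] r(1)[of n]] near[OF mn(1)] near[OF mn(2)]
        nrm_minus_commute[OF NE r(1) r(1), of M n] e by simp
    then show ?thesis by blast
  qed
  obtain w where w: "w \<in> carr E" "(\<lambda>n. nrm E (r n - w)) \<longlonglongrightarrow> 0"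
    using banach_space_complete[OF B r(1) cauchy] by blast
  \<comment> \<open>The limit provided by completeness is identified coordinatewise: the coordinate
    \<open>k\<close> of the truncations is constant from index \<open>Suc k\<close> on.\<close>
  have "w k = x k" for k
  proof -
    have "(\<lambda>n. r n k) \<longlonglongrightarrow> x k"
      by (rule tendsto_eventually) (auto simp: r_def restr_def eventually_sequentially intro: exI[of _ "Suc k"])
    then show ?thesis
      using lattice_tendsto_coordinate[OF E r(1) w] LIMSEQ_unique by blast
  qed
  then have "w = x" by auto
  with w show ?thesis by (simp add: r_def)
qed

text \<open>The nonnegative part of the unit ball of the Koethe dual of \<open>E\<close>.
  Summability is demanded separately because \<open>suminf\<close> is meaningful only for convergent
  series.\<close>

definition koethe_ball :: "(real, nat \<Rightarrow> real) nspace \<Rightarrow> (nat \<Rightarrow> real) set"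
  where "koethe_ball E = {g. (\<forall>k. 0 \<le> g k) \<and>
    (\<forall>x\<in>carr E. summable (\<lambda>k. g k * \<bar>x k\<bar>) \<and> (\<Sum>k. g k * \<bar>x k\<bar>) \<le> nrm E x)}"

text \<open>Order continuity determines \<open>e\<close> by its values \<open>c k\<close> on the
  unit vectors. Solidity allows the signs of coordinates to be changed freely, so the weights
  \<open>\<bar>c k\<bar>\<close> still define a contractive functional; passing to absolute values
  is why \<open>e x\<close> is only bounded from above.\<close>

lemma koethe_representation:
  assumes E: "banach_sequence_lattice E" and um: "uniformly_monotone E" and e: "e \<in> dual_sphere E"
  obtains g where "g \<in> koethe_ball E" "\<And>x. x \<in> carr E \<Longrightarrow> e x \<le> (\<Sum>k. g k * \<bar>x k\<bar>)"
proof -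
  note NE = lattice_normed_space[OF E]
  have ed: "e \<in> dual E" using e by (simp add: dual_sphere_def)
  define c where "c k = e (restr {k} (\<lambda>_. 1))" for k
  have fin: "e (restr {..<N} x) = (\<Sum>k<N. c k * x k)" for N x
  proof (induction N)
    case 0
    have "restr {..<0} x = 0" by (auto simp: restr_def)
    then show ?case by (simp only: dual_zero[OF NE ed]) simp
  next
    case (Suc N)
    have c1: "restr {N} (\<lambda>_. 1) \<in> carr E" "restr {..<N} x \<in> carr E"
      by (rule lattice_restr_finite[OF E], simp)+
    have "restr {..<Suc N} x = restr {..<N} x + scal E (x N) (restr {N} (\<lambda>_. 1))"
      by (auto simp: restr_def lattice_scal[OF E] fun_eq_iff less_Suc_eq)
    then have "e (restr {..<Suc N} x) = e (restr {..<N} x) + x N * c N"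
      by (simp add: dual_add[OF NE ed] dual_scal[OF NE ed] scal_carr[OF NE] c1 c_def)
    with Suc show ?case by simp
  qed
  have sums: "(\<lambda>k. c k * x k) sums e x" if x: "x \<in> carr E" for x
  proof -
    have "\<bar>e (restr {..<N} x) - e x\<bar> \<le> nrm E (restr {..<N} x - x)" for N
      using dual_sphere_bound[OF NE e diff_carr[OF NE lattice_restr(1)[OF E x, of "{..<N}"] x]]
      by (simp add: dual_diff[OF NE ed] lattice_restr(1)[OF E x] x)
    then have "(\<lambda>N. e (restr {..<N} x) - e x) \<longlonglongrightarrow> 0"
      by (intro Lim_null_comparison[OF _ uniformly_monotone_truncation[OF E um x]]) auto
    then show ?thesis by (simp add: LIM_zero_iff sums_def fin)
  qed
  have bound: "(\<Sum>k<N. \<bar>c k\<bar> * \<bar>x k\<bar>) \<le> nrm E x" if x: "x \<in> carr E" for N x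
  proof -
    \<comment> \<open>The signs of the \<open>c k\<close> are built into \<open>y\<close>, so that
      \<open>e y\<close> is the partial sum of absolute values, while solidity keeps the norm of
      \<open>y\<close> below that of \<open>x\<close>.\<close>
    define y where "y = restr {..<N} (\<lambda>k. sgn (c k) * \<bar>x k\<bar>)"
    have y: "y \<in> carr E" "nrm E y \<le> nrm E x"
      unfolding y_def by (rule lattice_solid[OF E x], simp add: restr_def abs_mult abs_sgn_eq)+
    have "(\<Sum>k<N. \<bar>c k\<bar> * \<bar>x k\<bar>) = e y"
      unfolding y_def fin by (intro sum.cong) (auto simp: abs_sgn mult.assoc)
    also have "\<dots> \<le> nrm E y" using dual_sphere_bound[OF NE e y(1)] by simp
    finally show ?thesis using y(2) by simp
  qed
  have summ: "summable (\<lambda>k. \<bar>c k\<bar> * \<bar>x k\<bar>)" if x: "x \<in> carr E" for x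
    by (rule bounded_imp_summable[where B = "nrm E x"]) (use bound[OF x, of "Suc _"] in \<open>auto simp: lessThan_Suc_atMost\<close>)
  show thesis
  proof (rule that[of "\<lambda>k. \<bar>c k\<bar>"])
    show "(\<lambda>k. \<bar>c k\<bar>) \<in> koethe_ball E"
      using summ bound by (auto simp: koethe_ball_def intro!: suminf_le_const)
    show "e x \<le> (\<Sum>k. \<bar>c k\<bar> * \<bar>x k\<bar>)" if x: "x \<in> carr E" for x
    proof -
      have "e x = (\<Sum>k. c k * x k)" using sums[OF x] by (simp add: sums_iff)
      also have "\<dots> \<le> (\<Sum>k. \<bar>c k\<bar> * \<bar>x k\<bar>)"
        using sums[OF x] summ[OF x] abs_ge_self
        by (intro suminf_le) (auto simp: sums_iff abs_mult[symmetric])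
      finally show ?thesis .
    qed
  qed
qed

text \<open>Absolute values of the points given by the AHSp are no farther from the nonnegative
  \<open>a n\<close>, and the functional is replaced by its Koethe weights. The weighted sum of
  \<open>b n\<close> is at least the old value 1 and at most the norm 1, hence exactly 1.\<close>

lemma lattice_AHSp_positive:
  assumes E: "banach_sequence_lattice E" and ah: "AHSp E" and um: "uniformly_monotone E"
    and "0 < \<epsilon>" "\<epsilon> < 1"
  obtains \<eta> where "0 < \<eta>" "\<eta> < \<epsilon>"
    "\<forall>a \<alpha> t. (\<forall>n. a n \<in> unit_sphere E) \<and> (\<forall>n k. 0 \<le> a n k) \<and> convex_series \<alpha> \<and>
        series_sums E (\<lambda>n. scal E (\<alpha> n) (a n)) t \<and> 1 - \<eta> < nrm E t \<longrightarrow>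
      (\<exists>A b g. (\<forall>n\<in>A. b n \<in> unit_sphere E \<and> (\<forall>k. 0 \<le> b n k) \<and> nrm E (b n - a n) < \<epsilon> \<and>
          (\<lambda>k. g k * b n k) sums 1) \<and>
        (\<Sum>\<^sub>\<infinity>n\<in>A. \<alpha> n) > 1 - \<epsilon> \<and> g \<in> koethe_ball E)"
proof -
  note NE = lattice_normed_space[OF E]
  obtain \<eta> where \<eta>: "0 < \<eta>" "\<eta> < \<epsilon>" and H: "\<forall>x \<alpha> s. range x \<subseteq> unit_sphere E \<and> convex_series \<alpha> \<and>
            series_sums E (\<lambda>n. scal E (of_real (\<alpha> n)) (x n)) s \<and> nrm E s > 1 - \<eta> \<longrightarrow>
          (\<exists>(A::nat set) z. z ` A \<subseteq> unit_sphere E \<and>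
            (\<Sum>\<^sub>\<infinity>k\<in>A. \<alpha> k) > 1 - \<epsilon> \<and>
            (\<forall>k\<in>A. nrm E (z k - x k) < \<epsilon>) \<and>
            (\<exists>f\<in>dual_sphere E. \<forall>k\<in>A. f (z k) = 1))"
    using ah[unfolded AHSp_def, THEN conjunct2, THEN spec, THEN mp, OF conjI[OF assms(4,5)]] by blast
  show thesis
  proof (rule that[OF \<eta>], intro allI impI)
    fix a :: "nat \<Rightarrow> nat \<Rightarrow> real" and \<alpha> t
    assume as: "(\<forall>n. a n \<in> unit_sphere E) \<and> (\<forall>n k. 0 \<le> a n k) \<and> convex_series \<alpha> \<and>
        series_sums E (\<lambda>n. scal E (\<alpha> n) (a n)) t \<and> 1 - \<eta> < nrm E t"
    then have a: "\<And>n. a n \<in> unit_sphere E" and a0: "\<And>n k. 0 \<le> a n k" and *: "convex_series \<alpha>"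
        "series_sums E (\<lambda>n. scal E (\<alpha> n) (a n)) t" "1 - \<eta> < nrm E t" by auto
    obtain A z f where z: "z ` A \<subseteq> unit_sphere E" "(\<Sum>\<^sub>\<infinity>k\<in>A. \<alpha> k) > 1 - \<epsilon>"
        and za: "\<And>k. k \<in> A \<Longrightarrow> nrm E (z k - a k) < \<epsilon>" and f: "f \<in> dual_sphere E"
        and fz: "\<And>k. k \<in> A \<Longrightarrow> f (z k) = 1"
      using H[rule_format, of a \<alpha> t] a * by (auto simp: image_subset_iff)
    obtain g where g: "g \<in> koethe_ball E" and fg: "\<And>x. x \<in> carr E \<Longrightarrow> f x \<le> (\<Sum>k. g k * \<bar>x k\<bar>)"
      using koethe_representation[OF E um f] by blast
    define b where "b n = (\<lambda>k. \<bar>z n k\<bar>)" for n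
    have "b n \<in> unit_sphere E \<and> (\<forall>k. 0 \<le> b n k) \<and> nrm E (b n - a n) < \<epsilon> \<and>
          (\<lambda>k. g k * b n k) sums 1" if n: "n \<in> A" for n
    proof (intro conjI allI)
      have zn: "z n \<in> carr E" "nrm E (z n) = 1" using z(1) n by (auto simp: unit_sphere_def)
      have an: "a n \<in> carr E" using a by (auto simp: unit_sphere_def)
      show "b n \<in> unit_sphere E" using lattice_abs[OF E zn(1)] zn by (simp add: b_def unit_sphere_def)
      show "0 \<le> b n k" for k by (simp add: b_def)
      have "nrm E (b n - a n) \<le> nrm E (z n - a n)"
      proof (rule lattice_solid(2)[OF E diff_carr[OF NE zn(1) an]])
        fix k show "\<bar>(b n - a n) k\<bar> \<le> \<bar>(z n - a n) k\<bar>" using a0[of n k] by (simp add: b_def)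
      qed
      then show "nrm E (b n - a n) < \<epsilon>" using za[OF n] by simp
      have "summable (\<lambda>k. g k * b n k)" "(\<Sum>k. g k * b n k) \<le> 1"
        using g zn by (auto simp: koethe_ball_def b_def)
      moreover have "1 \<le> (\<Sum>k. g k * b n k)" using fg[OF zn(1)] fz[OF n] by (simp add: b_def)
      ultimately show "(\<lambda>k. g k * b n k) sums 1" by (simp add: sums_iff)
    qed
    then show "\<exists>A b g. (\<forall>n\<in>A. b n \<in> unit_sphere E \<and> (\<forall>k. 0 \<le> b n k) \<and> nrm E (b n - a n) < \<epsilon> \<and>
          (\<lambda>k. g k * b n k) sums 1) \<and> (\<Sum>\<^sub>\<infinity>n\<in>A. \<alpha> n) > 1 - \<epsilon> \<and> g \<in> koethe_ball E"
      using z(2) g by blast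
  qed
qed

subsection \<open>Contractive functionals\<close>

text \<open>The closed unit ball of the dual, described by the pointwise bound so that no supremum
  has to be handled when functionals are glued or rotated.\<close>

definition dual_ball :: "('k::real_or_complex, 'v::ab_group_add) nspace \<Rightarrow> ('v \<Rightarrow> 'k) set"
  where "dual_ball X = {f \<in> dual X. \<forall>x\<in>carr X. norm (f x) \<le> nrm X x}"

lemma dual_ball_dual: "f \<in> dual_ball X \<Longrightarrow> f \<in> dual X"
  and dual_ball_bound: "f \<in> dual_ball X \<Longrightarrow> x \<in> carr X \<Longrightarrow> norm (f x) \<le> nrm X x"
  by (auto simp: dual_ball_def)

lemma dual_ballI:
  assumes "\<And>x y. x \<in> carr X \<Longrightarrow> y \<in> carr X \<Longrightarrow> f (x + y) = f x + f y"
    and "\<And>c x. x \<in> carr X \<Longrightarrow> f (scal X c x) = c * f x"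
    and "\<And>x. x \<in> carr X \<Longrightarrow> norm (f x) \<le> nrm X x"
  shows "f \<in> dual_ball X"
  using assms by (auto simp: dual_ball_def dual_def intro!: exI[of _ 1])

lemma dual_sphere_subset_ball: "normed_space X \<Longrightarrow> dual_sphere X \<subseteq> dual_ball X"
  using dual_sphere_bound by (auto simp: dual_ball_def dual_sphere_def)

lemma dual_ball_mult:
  assumes X: "normed_space X" and f: "f \<in> dual_ball X" and l: "norm l = 1"
  shows "(\<lambda>x. l * f x) \<in> dual_ball X"
  using dual_add[OF X dual_ball_dual[OF f]] dual_scal[OF X dual_ball_dual[OF f]] dual_ball_bound[OF f] l
  by (intro dual_ballI) (auto simp: norm_mult algebra_simps)

lemma dual_ball_series:
  assumes X: "normed_space X" and f: "f \<in> dual_ball X" and z: "\<And>n. z n \<in> carr X"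
    and s: "series_sums X z s"
  shows "(\<lambda>n. f (z n)) sums f s"
proof -
  note fd = dual_ball_dual[OF f]
  have sc: "s \<in> carr X" and lim: "(\<lambda>n. nrm X ((\<Sum>i<n. z i) - s)) \<longlonglongrightarrow> 0"
    using s by (auto simp: series_sums_def)
  have pc: "(\<Sum>i<n. z i) \<in> carr X" for n using z by (intro sum_carr[OF X])
  have "norm ((\<Sum>i<n. f (z i)) - f s) \<le> nrm X ((\<Sum>i<n. z i) - s)" for n
    using dual_ball_bound[OF f diff_carr[OF X pc sc], of n] z
    by (simp add: dual_diff[OF X fd pc sc] dual_sum[OF X fd])
  then have "(\<lambda>n. (\<Sum>i<n. f (z i)) - f s) \<longlonglongrightarrow> 0"
    by (intro Lim_null_comparison[OF _ lim]) auto
  then show ?thesis by (simp add: LIM_zero_iff sums_def)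
qed

text \<open>A norming set need not be closed under multiplication by scalars of modulus 1, so the
  functional chosen from it is rotated; the face assigned to it is rotated accordingly.\<close>

lemma AHp_support:
  fixes X :: "('k::real_or_complex, 'v::ab_group_add) nspace"
  assumes ah: "AHp_with \<delta> X" and \<epsilon>: "0 < \<epsilon>" "\<epsilon> < 1" and r: "r < 1" and s: "s \<in> carr X"
  obtains h p where "h \<in> dual_ball X" "p \<in> dual_ball X" "r * nrm X s \<le> re (h s)"
    "\<exists>y\<in>unit_sphere X. p y = 1"
    "\<And>x. x \<in> carr X \<Longrightarrow> (1 - \<delta> \<epsilon>) * nrm X x < re (h x) \<Longrightarrow>
      \<exists>y\<in>unit_sphere X. p y = 1 \<and> nrm X (scal X (of_real (nrm X x)) y - x) \<le> \<epsilon> * nrm X x"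
proof -
  have X: "normed_space X" using ah by (simp add: AHp_with_def banach_space_def)
  obtain C \<Upsilon> where C: "one_norming X C" and \<Upsilon>: "\<Upsilon> \<in> C \<rightarrow> dual_sphere X"
    and near: "\<And>f x. \<lbrakk>f \<in> C; x \<in> unit_sphere X; re (f x) > 1 - \<delta> \<epsilon>\<rbrakk> \<Longrightarrow>
      dist_to X x (face X (\<Upsilon> f)) < ereal \<epsilon>"
    using ah \<epsilon> unfolding AHp_with_def by (meson greaterThanLessThan_iff)
  have \<delta>: "0 < \<delta> \<epsilon>" using ah \<epsilon> by (auto simp: AHp_with_def)
  have CS: "C \<subseteq> dual_sphere X" "C \<noteq> {}" using C by (auto simp: one_norming_def)
  \<comment> \<open>For nonzero \<open>s\<close> the number \<open>r * nrm X s\<close> lies strictly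
    below the supremum over \<open>C\<close>; for \<open>s = 0\<close> any element of the nonempty
    set \<open>C\<close> will do.\<close>
  obtain f where f: "f \<in> C" and fs: "r * nrm X s \<le> norm (f s)"
  proof (cases "s = 0")
    case True
    then show thesis using CS that by (auto simp: nrm_zero[OF X])
  next
    case False
    then have "nrm X s > 0" using nrm_nonneg[OF X s] nrm_eq_0_iff[OF X s] by simp
    then have "r * nrm X s < (SUP f\<in>C. norm (f s))"
      using C s r by (simp add: one_norming_def)
    then obtain v where "v \<in> (\<lambda>f. norm (f s)) ` C" "r * nrm X s < v"
      using less_cSupD[of "(\<lambda>f. norm (f s)) ` C"] CS(2) by blast
    then show thesis using that by auto
  qed
  have fS: "f \<in> dual_sphere X" and uS: "\<Upsilon> f \<in> dual_sphere X" using f CS(1) \<Upsilon> by auto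
  then have fB: "f \<in> dual_ball X" and uB: "\<Upsilon> f \<in> dual_ball X"
    using dual_sphere_subset_ball[OF X] by auto
  define l where "l = (if f s = 0 then 1 else of_real (norm (f s)) / f s)"
  have l: "norm l = 1" "l \<noteq> 0" by (auto simp: l_def norm_divide)
  have ls: "l * f s = of_real (norm (f s))" by (simp add: l_def)
  have face1: "\<Upsilon> f y = 1" if "y \<in> face X (\<Upsilon> f)" for y
    using that dual_ball_bound[OF uB, of y] by (auto simp: face_def unit_sphere_def intro: re_eq_1_imp_eq_1)
  have support: "\<exists>y\<in>unit_sphere X. l * \<Upsilon> f y = 1 \<and>
      nrm X (scal X (of_real (nrm X x)) y - x) \<le> \<epsilon> * nrm X x"
    if x: "x \<in> carr X" and xl: "(1 - \<delta> \<epsilon>) * nrm X x < re (l * f x)" for x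
  proof -
    define c where "c = nrm X x"
    have "x \<noteq> 0" using xl dual_zero[OF X dual_ball_dual[OF fB]] by (auto simp: nrm_zero[OF X] re_def)
    then have c: "c > 0" using nrm_nonneg[OF X x] nrm_eq_0_iff[OF X x] by (simp add: c_def)
    \<comment> \<open>Normalised and rotated so that \<open>f x'\<close> equals
      \<open>l * f x / c\<close>, which is the quantity the AHp hypothesis on \<open>f\<close>
      speaks about.\<close>
    define x' where "x' = scal X (of_real (1 / c) * l) x"
    have x': "x' \<in> unit_sphere X"
      using c l by (simp add: x'_def unit_sphere_def scal_carr[OF X x] nrm_scal[OF X x] norm_mult norm_divide c_def)
    then have x'c: "x' \<in> carr X" by (simp add: unit_sphere_def)
    have "re (f x') = re (l * f x) / c"
      using re_of_real_mult[of "1 / c" "l * f x"]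
      by (simp add: x'_def dual_scal[OF X dual_ball_dual[OF fB] x] mult.assoc)
    also have "\<dots> > 1 - \<delta> \<epsilon>" using xl c by (simp add: c_def less_divide_eq)
    finally have "dist_to X x' (face X (\<Upsilon> f)) < ereal \<epsilon>" by (rule near[OF f x'])
    then obtain y' where y': "y' \<in> face X (\<Upsilon> f)" "nrm X (x' - y') < \<epsilon>"
      by (auto simp: dist_to_def INF_less_iff)
    have y'c: "y' \<in> carr X" "nrm X y' = 1" using y' by (auto simp: face_def unit_sphere_def)
    \<comment> \<open>Rotating back makes \<open>l * \<Upsilon> f\<close> take the value 1 at
      \<open>y\<close>. As \<open>l\<close> is unimodular, the distance from \<open>x\<close> is
      that between \<open>x'\<close> and \<open>y'\<close>, multiplied by \<open>c\<close>.\<close>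
    define y where "y = scal X (1 / l) y'"
    have xx': "x = scal X (of_real c / l) x'"
      using c l by (simp add: x'_def scal_scal[OF X] scal_one[OF X])
    have "scal X (of_real c) y - x = scal X (of_real c / l) (y' - x')"
      by (subst xx') (simp add: y_def scal_scal[OF X] scal_diff_right[OF X])
    then have "nrm X (scal X (of_real c) y - x) = c * nrm X (x' - y')"
      using c l by (simp add: nrm_scal[OF X diff_carr[OF X y'c(1) x'c]] norm_divide
          nrm_minus_commute[OF X x'c y'c(1)])
    also have "\<dots> \<le> \<epsilon> * c" using y'(2) c by (simp add: mult.commute)
    finally have "nrm X (scal X (of_real c) y - x) \<le> \<epsilon> * c" .
    moreover have "y \<in> unit_sphere X"
      using y'c l by (simp add: y_def unit_sphere_def scal_carr[OF X] nrm_scal[OF X] norm_divide)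
    moreover have "l * \<Upsilon> f y = 1"
      using face1[OF y'(1)] l by (simp add: y_def dual_scal[OF X dual_ball_dual[OF uB] y'c(1)])
    ultimately show ?thesis unfolding c_def by blast
  qed
  show thesis
  proof (rule that[of "\<lambda>x. l * f x" "\<lambda>x. l * \<Upsilon> f x"])
    show "(\<lambda>x. l * f x) \<in> dual_ball X" "(\<lambda>x. l * \<Upsilon> f x) \<in> dual_ball X"
      using dual_ball_mult[OF X fB l(1)] dual_ball_mult[OF X uB l(1)] by auto
    show "r * nrm X s \<le> re (l * f s)" using fs by (simp only: ls re_of_real)
    \<comment> \<open>The face is nonempty: \<open>f\<close> almost attains its norm somewhere, and
      \<open>support\<close>, applied to the rotated point, then yields an element.\<close>
    obtain x where x: "x \<in> unit_sphere X" "re (f x) > 1 - \<delta> \<epsilon>"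
      using dual_sphere_almost_attained[OF X fS \<delta>] by blast
    have xc: "x \<in> carr X" "nrm X x = 1" using x by (auto simp: unit_sphere_def)
    have "l * f (scal X (1 / l) x) = f x"
      using l by (simp add: dual_scal[OF X dual_ball_dual[OF fB] xc(1)])
    moreover have "nrm X (scal X (1 / l) x) = 1"
      using l xc by (simp add: nrm_scal[OF X] norm_divide)
    ultimately show "\<exists>y\<in>unit_sphere X. l * \<Upsilon> f y = 1"
      using support[OF scal_carr[OF X xc(1), of "1 / l"]] x(2) by auto
  qed (use support in auto)
qed

subsection \<open>Series\<close>

lemma sum_fun_apply: "(sum f A) k = (\<Sum>i\<in>A. f i k)"
  for f :: "'i \<Rightarrow> 'a \<Rightarrow> 'b::comm_monoid_add"
  by (induction A rule: infinite_finite_induct) auto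

lemma banach_absolutely_convergent:
  assumes B: "banach_space X" and z: "\<And>n. z n \<in> carr X" and summ: "summable (\<lambda>n. nrm X (z n))"
  obtains s where "series_sums X z s"
proof -
  have X: "normed_space X" using B by (simp add: banach_space_def)
  define P Q where "P n = (\<Sum>i<n. z i)" and "Q n = (\<Sum>i<n. nrm X (z i))" for n
  have P: "P n \<in> carr X" for n unfolding P_def using z by (intro sum_carr[OF X])
  have le: "nrm X (P m - P n) \<le> \<bar>Q m - Q n\<bar>" if "n \<le> m" for m n
  proof -
    have "{..<n} \<subseteq> {..<m}" using that by auto
    note d = sum_diff[OF finite_lessThan this]
    have "P m - P n = (\<Sum>i\<in>{..<m} - {..<n}. z i)" "Q m - Q n = (\<Sum>i\<in>{..<m} - {..<n}. nrm X (z i))"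
      by (simp_all only: P_def Q_def d)
    then show ?thesis using nrm_sum_le[OF X, of "{..<m} - {..<n}" z] z by simp
  qed
  have le: "nrm X (P m - P n) \<le> \<bar>Q m - Q n\<bar>" for m n
    using le[of n m] le[of m n] nrm_minus_commute[OF X P[of m] P[of n]] by (cases "n \<le> m") auto
  have "Cauchy Q" using summ unfolding Q_def summable_iff_convergent Cauchy_convergent_iff .
  then have cauchy: "\<exists>M. \<forall>m\<ge>M. \<forall>n\<ge>M. nrm X (P m - P n) < e" if "e > 0" for e
    using that le unfolding Cauchy_def dist_real_def by (meson le_less_trans)
  obtain s where "s \<in> carr X" "(\<lambda>n. nrm X (P n - s)) \<longlonglongrightarrow> 0"
    using banach_space_complete[OF B P cauchy] by blast
  then show thesis using that by (simp add: series_sums_def P_def)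
qed

lemma convex_series_partial_sum_le:
  assumes "convex_series \<alpha>"
  shows "(\<Sum>i<n. \<alpha> i) \<le> 1"
  using assms sum_le_suminf[of \<alpha> "{..<n}"] by (auto simp: convex_series_def sums_iff)

lemma nrm_convex_series_le:
  assumes X: "normed_space X" and \<alpha>: "convex_series \<alpha>" and x: "\<And>n. x n \<in> unit_sphere X"
    and s: "series_sums X (\<lambda>n. scal X (of_real (\<alpha> n)) (x n)) s"
  shows "nrm X s \<le> 1"
proof -
  have xc: "x n \<in> carr X" "nrm X (x n) = 1" for n using x by (auto simp: unit_sphere_def)
  have zc: "scal X (of_real (\<alpha> n)) (x n) \<in> carr X" for n by (rule scal_carr[OF X xc(1)])
  define P where "P n = (\<Sum>i<n. scal X (of_real (\<alpha> i)) (x i))" for n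
  have P: "P n \<in> carr X" for n unfolding P_def using zc by (intro sum_carr[OF X])
  have "(\<lambda>n. nrm X (P n)) \<longlonglongrightarrow> nrm X s"
    using s by (intro tendsto_nrm[OF X P]) (auto simp: series_sums_def P_def)
  moreover have "nrm X (P n) \<le> 1" for n
  proof -
    have "nrm X (P n) \<le> (\<Sum>i<n. nrm X (scal X (of_real (\<alpha> i)) (x i)))"
      unfolding P_def by (rule nrm_sum_le[OF X zc])
    also have "\<dots> = (\<Sum>i<n. \<alpha> i)"
      using \<alpha> xc by (intro sum.cong) (auto simp: nrm_scal[OF X] convex_series_def)
    also have "\<dots> \<le> 1" by (rule convex_series_partial_sum_le[OF \<alpha>])
    finally show ?thesis .
  qed
  ultimately show ?thesis by (intro Lim_bounded[of "\<lambda>n. nrm X (P n)"]) auto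
qed

lemma convex_series_summable_on:
  assumes "convex_series \<alpha>"
  shows "\<alpha> summable_on A"
proof -
  have "\<alpha> summable_on UNIV"
    using assms by (intro norm_summable_imp_summable_on) (auto simp: convex_series_def sums_iff)
  then show ?thesis using summable_on_subset_banach by blast
qed

text \<open>Markov's inequality for the probability weights \<alpha>: the indices of
  \<open>A\<close> with \<open>\<Phi> n > \<mu>\<close> carry total weight at most
  \<open>\<kappa> / \<mu>\<close>.\<close>

lemma convex_series_markov:
  assumes \<alpha>: "convex_series \<alpha>" and \<Phi>: "\<And>n. 0 \<le> \<Phi> n" and le: "\<And>N. (\<Sum>n<N. \<alpha> n * \<Phi> n) \<le> \<kappa>"
    and \<mu>: "\<mu> > 0"
  shows "(\<Sum>\<^sub>\<infinity>n\<in>A. \<alpha> n) - \<kappa> / \<mu> \<le> (\<Sum>\<^sub>\<infinity>n\<in>A \<inter> {n. \<Phi> n \<le> \<mu>}. \<alpha> n)"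
proof -
  define B where "B = A - {n. \<Phi> n \<le> \<mu>}"
  have a0: "0 \<le> \<alpha> n" for n using \<alpha> by (simp add: convex_series_def)
  have "(\<Sum>\<^sub>\<infinity>n\<in>B. \<alpha> n) \<le> \<kappa> / \<mu>"
  proof (rule infsum_le_finite_sums[OF convex_series_summable_on[OF \<alpha>]])
    fix F assume F: "finite F" "F \<subseteq> B"
    obtain N where N: "F \<subseteq> {..<N}" using F(1) finite_nat_iff_bounded by blast
    have "sum \<alpha> F * \<mu> \<le> (\<Sum>n\<in>F. \<alpha> n * \<Phi> n)"
      unfolding sum_distrib_right using F a0 by (intro sum_mono mult_left_mono) (auto simp: B_def)
    also have "\<dots> \<le> (\<Sum>n<N. \<alpha> n * \<Phi> n)"
      using N a0 \<Phi> by (intro sum_mono2) auto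
    also have "\<dots> \<le> \<kappa>" by (rule le)
    finally show "sum \<alpha> F \<le> \<kappa> / \<mu>" using \<mu> by (simp add: le_divide_eq)
  qed
  moreover have "(\<Sum>\<^sub>\<infinity>n\<in>A. \<alpha> n) = (\<Sum>\<^sub>\<infinity>n\<in>A \<inter> {n. \<Phi> n \<le> \<mu>}. \<alpha> n) + (\<Sum>\<^sub>\<infinity>n\<in>B. \<alpha> n)"
    by (subst infsum_Un_disjoint[symmetric])
      (auto simp: B_def Int_Diff_Un intro: convex_series_summable_on[OF \<alpha>])
  ultimately show ?thesis by simp
qed

subsection \<open>Lattice sums\<close>

lemma Esum_simps:
  shows scal_Esum: "scal (E_sum E X) c x = (\<lambda>k. scal (X k) c (x k))"
    and carr_Esum: "x \<in> carr (E_sum E X) \<longleftrightarrow> (\<forall>k. x k \<in> carr (X k)) \<and> (\<lambda>k. nrm (X k) (x k)) \<in> carr E"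
    and nrm_Esum: "nrm (E_sum E X) x = nrm E (\<lambda>k. nrm (X k) (x k))"
  by (simp_all add: E_sum_def)

text \<open>Solidity of \<open>E\<close>, lifted to vector-valued sequences; it reduces membership
  and norm estimates in the sum to coordinatewise majorants.\<close>

lemma Esum_dominated:
  assumes E: "banach_sequence_lattice E" and X: "\<And>k. normed_space (X k)"
    and x: "\<And>k. x k \<in> carr (X k)" and y: "y \<in> carr E" and le: "\<And>k. nrm (X k) (x k) \<le> y k"
  shows "x \<in> carr (E_sum E X)" "nrm (E_sum E X) x \<le> nrm E y"
proof -
  have "\<bar>nrm (X k) (x k)\<bar> \<le> \<bar>y k\<bar>" for k using le[of k] nrm_nonneg[OF X x, of k] by simp
  from lattice_solid[OF E y this] show "x \<in> carr (E_sum E X)" "nrm (E_sum E X) x \<le> nrm E y"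
    using x by (simp_all add: carr_Esum nrm_Esum)
qed

lemma Esum_normed_space:
  assumes E: "banach_sequence_lattice E" and X: "\<And>k. normed_space (X k)"
  shows "normed_space (E_sum E X)"
proof -
  note NE = lattice_normed_space[OF E]
  have vs: "vector_space (scal (E_sum E X))"
    by (rule vector_space.intro)
      (auto simp: scal_Esum scal_add_right[OF X] scal_add_left[OF X] scal_scal[OF X] scal_one[OF X] fun_eq_iff)
  have add: "x + y \<in> carr (E_sum E X)" "nrm (E_sum E X) (x + y) \<le> nrm (E_sum E X) x + nrm (E_sum E X) y"
    if x: "x \<in> carr (E_sum E X)" and y: "y \<in> carr (E_sum E X)" for x y
  proof -
    define u v where "u = (\<lambda>k. nrm (X k) (x k))" and "v = (\<lambda>k. nrm (X k) (y k))"
    have xk: "x k \<in> carr (X k)" "y k \<in> carr (X k)" for k using x y by (auto simp: carr_Esum)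
    have uv: "u \<in> carr E" "v \<in> carr E" using x y by (auto simp: carr_Esum u_def v_def)
    have s: "x + y \<in> carr (E_sum E X) \<and> nrm (E_sum E X) (x + y) \<le> nrm E (u + v)"
      using xk by (intro conjI Esum_dominated[OF E X _ add_carr[OF NE uv]])
        (auto simp: u_def v_def add_carr[OF X] nrm_triangle[OF X])
    then show "x + y \<in> carr (E_sum E X)" by simp
    show "nrm (E_sum E X) (x + y) \<le> nrm (E_sum E X) x + nrm (E_sum E X) y"
      using s nrm_triangle[OF NE uv] unfolding nrm_Esum[of E X x] nrm_Esum[of E X y]
      by (simp add: u_def v_def)
  qed
  have sc: "scal (E_sum E X) c x \<in> carr (E_sum E X) \<and>
      nrm (E_sum E X) (scal (E_sum E X) c x) = norm c * nrm (E_sum E X) x"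
    if x: "x \<in> carr (E_sum E X)" for c x
  proof -
    have xk: "x k \<in> carr (X k)" for k using x by (auto simp: carr_Esum)
    have u: "(\<lambda>k. nrm (X k) (x k)) \<in> carr E" using x by (auto simp: carr_Esum)
    have "(\<lambda>k. nrm (X k) (scal (X k) c (x k))) = scal E (norm c) (\<lambda>k. nrm (X k) (x k))"
      by (simp add: lattice_scal[OF E] nrm_scal[OF X xk])
    then show ?thesis
      using scal_carr[OF NE u] nrm_scal[OF NE u, of "norm c"] scal_carr[OF X xk]
      by (simp add: scal_Esum carr_Esum nrm_Esum)
  qed
  have zero: "0 \<in> carr (E_sum E X)"
    using zero_carr[OF NE] zero_carr[OF X] by (simp add: carr_Esum nrm_zero[OF X] zero_fun_def)
  have z: "0 \<le> nrm (E_sum E X) x \<and> (nrm (E_sum E X) x = 0 \<longleftrightarrow> x = 0)"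
    if x: "x \<in> carr (E_sum E X)" for x
  proof -
    have xk: "x k \<in> carr (X k)" for k using x by (auto simp: carr_Esum)
    have u: "(\<lambda>k. nrm (X k) (x k)) \<in> carr E" using x by (auto simp: carr_Esum)
    show ?thesis
      using nrm_nonneg[OF NE u] nrm_eq_0_iff[OF NE u] nrm_eq_0_iff[OF X xk]
      by (simp add: nrm_Esum fun_eq_iff)
  qed
  interpret vector_space "scal (E_sum E X)" by (rule vs)
  have "subspace (carr (E_sum E X))"
    using zero add sc by (intro subspaceI) auto
  then show ?thesis
    unfolding normed_space_def using vs add sc z by blast
qed

section \<open>Completeness of the lattice sum\<close>

lemma Esum_coordinate_bound:
  assumes E: "banach_sequence_lattice E" and X: "\<And>k. normed_space (X k)"
  obtains C where "C > 0" "\<And>x. x \<in> carr (E_sum E X) \<Longrightarrow> nrm (X k) (x k) \<le> C * nrm (E_sum E X) x"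
proof -
  obtain C where "C > 0" and C: "\<And>x. x \<in> carr E \<Longrightarrow> \<bar>x k\<bar> \<le> C * nrm E x"
    using lattice_coordinate_bound[OF E] by blast
  moreover have "nrm (X k) (x k) \<le> C * nrm (E_sum E X) x" if "x \<in> carr (E_sum E X)" for x
    using C[of "\<lambda>k. nrm (X k) (x k)"] that by (auto simp: carr_Esum nrm_Esum)
  ultimately show thesis using that by blast
qed

text \<open>By the reverse triangle inequality and solidity the norm sequences are Cauchy in
  \<open>E\<close>, and their limit there can be read off coordinatewise. This plays the part of a
  Fatou property for Cauchy sequences.\<close>

lemma Esum_cauchy_coordinatewise:
  assumes E: "banach_sequence_lattice E" and X: "\<And>k. normed_space (X k)"
    and \<tau>: "\<And>n. \<tau> n \<in> carr (E_sum E X)"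
    and cauchy: "\<And>e. e > 0 \<Longrightarrow> \<exists>M. \<forall>m\<ge>M. \<forall>n\<ge>M. nrm (E_sum E X) (\<tau> m - \<tau> n) < e"
    and y: "\<And>k. y k \<in> carr (X k)" and lim: "\<And>k. (\<lambda>n. nrm (X k) (\<tau> n k - y k)) \<longlonglongrightarrow> 0"
  shows "y \<in> carr (E_sum E X)" "(\<lambda>n. nrm (E_sum E X) (\<tau> n)) \<longlonglongrightarrow> nrm (E_sum E X) y"
proof -
  note NE = lattice_normed_space[OF E] and NZ = Esum_normed_space[OF E X]
  have B: "banach_space E" using E by (simp add: banach_sequence_lattice_def)
  define p where "p n = (\<lambda>k. nrm (X k) (\<tau> n k))" for n
  have \<tau>k: "\<tau> n k \<in> carr (X k)" for n k using \<tau>[of n] by (simp add: carr_Esum)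
  have p: "p n \<in> carr E" for n using \<tau>[of n] by (simp add: carr_Esum p_def)
  have "nrm E (p m - p n) \<le> nrm (E_sum E X) (\<tau> m - \<tau> n)" for m n
  proof -
    have d: "(\<lambda>k. nrm (X k) ((\<tau> m - \<tau> n) k)) \<in> carr E"
      using diff_carr[OF NZ \<tau> \<tau>] by (simp add: carr_Esum)
    have "\<bar>(p m - p n) k\<bar> \<le> \<bar>nrm (X k) ((\<tau> m - \<tau> n) k)\<bar>" for k
      using order_trans[OF abs_nrm_diff_le[OF X \<tau>k[of m k] \<tau>k[of n k]] abs_ge_self] by (simp add: p_def)
    then show ?thesis unfolding nrm_Esum by (rule lattice_solid(2)[OF E d])
  qed
  then have p_cauchy: "\<exists>M. \<forall>m\<ge>M. \<forall>n\<ge>M. nrm E (p m - p n) < e" if "e > 0" for e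
    using cauchy[OF that] by (meson le_less_trans)
  obtain w where w: "w \<in> carr E" "(\<lambda>n. nrm E (p n - w)) \<longlonglongrightarrow> 0"
    using banach_space_complete[OF B p p_cauchy] by blast
  have "w k = nrm (X k) (y k)" for k
    using LIMSEQ_unique[OF lattice_tendsto_coordinate[OF E p w, of k]]
      tendsto_nrm[OF X \<tau>k y lim, of k] by (simp add: p_def)
  then have wy: "w = (\<lambda>k. nrm (X k) (y k))" by auto
  show "y \<in> carr (E_sum E X)" using w(1) y by (simp add: carr_Esum wy)
  show "(\<lambda>n. nrm (E_sum E X) (\<tau> n)) \<longlonglongrightarrow> nrm (E_sum E X) y"
    using tendsto_nrm[OF NE p w] by (simp add: nrm_Esum wy p_def[abs_def])
qed

lemma Esum_banach_space:
  assumes E: "banach_sequence_lattice E" and X: "\<And>k. banach_space (X k)"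
  shows "banach_space (E_sum E X)"
proof -
  have NX: "normed_space (X k)" for k using X[of k] by (simp add: banach_space_def)
  note NZ = Esum_normed_space[OF E NX]
  let ?Z = "E_sum E X"
  have "\<exists>y\<in>carr ?Z. (\<lambda>n. nrm ?Z (\<sigma> n - y)) \<longlonglongrightarrow> 0"
    if "range \<sigma> \<subseteq> carr ?Z" and cauchy: "\<forall>e>0. \<exists>M. \<forall>m\<ge>M. \<forall>n\<ge>M. nrm ?Z (\<sigma> m - \<sigma> n) < e" for \<sigma>
  proof -
    have \<sigma>: "\<sigma> n \<in> carr ?Z" for n using that by auto
    have \<sigma>k: "\<sigma> n k \<in> carr (X k)" for n k using \<sigma>[of n] by (simp add: carr_Esum)
    have "\<exists>y\<in>carr (X k). (\<lambda>n. nrm (X k) (\<sigma> n k - y)) \<longlonglongrightarrow> 0" for k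
    proof -
      obtain C where C: "C > 0" "\<And>x. x \<in> carr ?Z \<Longrightarrow> nrm (X k) (x k) \<le> C * nrm ?Z x"
        using Esum_coordinate_bound[where E = E and X = X and k = k, OF E NX] by blast
      have cauchy_k: "\<exists>M. \<forall>m\<ge>M. \<forall>n\<ge>M. nrm (X k) (\<sigma> m k - \<sigma> n k) < e" if "e > 0" for e
      proof -
        have "e / C > 0" using that C by simp
        then obtain M where M: "\<And>m n. m \<ge> M \<Longrightarrow> n \<ge> M \<Longrightarrow> nrm ?Z (\<sigma> m - \<sigma> n) < e / C"
          using cauchy by blast
        have "nrm (X k) (\<sigma> m k - \<sigma> n k) < e" if "m \<ge> M" "n \<ge> M" for m n
        proof -
          have "nrm (X k) (\<sigma> m k - \<sigma> n k) \<le> C * nrm ?Z (\<sigma> m - \<sigma> n)"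
            using C(2)[OF diff_carr[OF NZ \<sigma> \<sigma>]] by simp
          also have "\<dots> < C * (e / C)" using M[OF that] C(1) by (intro mult_strict_left_mono)
          finally show ?thesis using C(1) by simp
        qed
        then show ?thesis by blast
      qed
      show ?thesis using banach_space_complete[OF X \<sigma>k cauchy_k] by blast
    qed
    then obtain y where y: "\<And>k. y k \<in> carr (X k)" "\<And>k. (\<lambda>n. nrm (X k) (\<sigma> n k - y k)) \<longlonglongrightarrow> 0"
      by metis
    have yZ: "y \<in> carr ?Z"
      using Esum_cauchy_coordinatewise(1)[OF E NX \<sigma> _ y] cauchy by blast
    \<comment> \<open>For fixed \<open>n\<close> the coordinatewise criterion is applied to the
      sequence \<open>\<sigma> n - \<sigma> m\<close> in \<open>m\<close>, so that the Cauchy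
      estimate survives the passage to the limit.\<close>
    have lim: "(\<lambda>m. nrm ?Z (\<sigma> n - \<sigma> m)) \<longlonglongrightarrow> nrm ?Z (\<sigma> n - y)" for n
    proof (rule Esum_cauchy_coordinatewise(2)[OF E NX])
      show "\<sigma> n - \<sigma> m \<in> carr ?Z" for m by (rule diff_carr[OF NZ \<sigma> \<sigma>])
      show "(\<sigma> n - y) k \<in> carr (X k)" for k using diff_carr[OF NX \<sigma>k y(1)] by simp
      show "(\<lambda>m. nrm (X k) ((\<sigma> n - \<sigma> m) k - (\<sigma> n - y) k)) \<longlonglongrightarrow> 0" for k
        using y(2)[of k] by (simp add: nrm_minus_commute[OF NX \<sigma>k y(1)])
      show "\<exists>M. \<forall>m\<ge>M. \<forall>l\<ge>M. nrm ?Z (\<sigma> n - \<sigma> m - (\<sigma> n - \<sigma> l)) < e" if e: "e > 0" for e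
      proof -
        obtain M where "\<forall>m\<ge>M. \<forall>n\<ge>M. nrm ?Z (\<sigma> m - \<sigma> n) < e" using cauchy e by blast
        then show ?thesis by (intro exI[of _ M]) simp
      qed
    qed
    have "(\<lambda>n. nrm ?Z (\<sigma> n - y)) \<longlonglongrightarrow> 0"
    proof (rule LIMSEQ_I)
      fix e :: real assume e: "e > 0"
      then have "e / 2 > 0" by simp
      then obtain M where M: "\<And>m n. m \<ge> M \<Longrightarrow> n \<ge> M \<Longrightarrow> nrm ?Z (\<sigma> m - \<sigma> n) < e / 2"
        using cauchy by blast
      have "nrm ?Z (\<sigma> n - y) \<le> e / 2" if "n \<ge> M" for n
        by (rule Lim_bounded[OF lim[of n], of M]) (use M[OF that] in \<open>auto intro: less_imp_le\<close>)
      then have "\<forall>n\<ge>M. norm (nrm ?Z (\<sigma> n - y) - 0) < e"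
        using e nrm_nonneg[OF NZ diff_carr[OF NZ \<sigma> yZ]] by fastforce
      then show "\<exists>M. \<forall>n\<ge>M. norm (nrm ?Z (\<sigma> n - y) - 0) < e" by blast
    qed
    with yZ show ?thesis by blast
  qed
  with NZ show ?thesis by (simp add: banach_space_def)
qed

section \<open>Functionals given by Koethe weights\<close>

lemma koethe_ballD:
  assumes "g \<in> koethe_ball E"
  shows "0 \<le> g k" "x \<in> carr E \<Longrightarrow> summable (\<lambda>k. g k * \<bar>x k\<bar>)"
    "x \<in> carr E \<Longrightarrow> (\<Sum>k. g k * \<bar>x k\<bar>) \<le> nrm E x"
  using assms by (auto simp: koethe_ball_def)

lemma koethe_functional:
  assumes E: "banach_sequence_lattice E" and g: "g \<in> koethe_ball E"
  shows koethe_summable: "x \<in> carr E \<Longrightarrow> summable (\<lambda>k. g k * x k)"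
    and koethe_dual_ball: "(\<lambda>x. \<Sum>k. g k * x k) \<in> dual_ball E"
proof -
  have s: "summable (\<lambda>k. \<bar>g k * x k\<bar>)" if "x \<in> carr E" for x
    using koethe_ballD(2)[OF g that] koethe_ballD(1)[OF g] by (simp add: abs_mult)
  then show s': "x \<in> carr E \<Longrightarrow> summable (\<lambda>k. g k * x k)" for x
    by (rule summable_rabs_cancel)
  show "(\<lambda>x. \<Sum>k. g k * x k) \<in> dual_ball E"
  proof (rule dual_ballI)
    show "(\<Sum>k. g k * (x + y) k) = (\<Sum>k. g k * x k) + (\<Sum>k. g k * y k)"
      if "x \<in> carr E" "y \<in> carr E" for x y
      using that by (simp add: suminf_add s' algebra_simps)
    show "(\<Sum>k. g k * scal E c x k) = c * (\<Sum>k. g k * x k)" if "x \<in> carr E" for c x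
      using suminf_mult[OF s'[OF that], of c] by (simp add: lattice_scal[OF E] algebra_simps)
    show "norm (\<Sum>k. g k * x k) \<le> nrm E x" if "x \<in> carr E" for x
      using summable_rabs[OF s[OF that]] koethe_ballD(1)[OF g] koethe_ballD(3)[OF g that]
      by (simp add: abs_mult)
  qed
qed

text \<open>The terms are dominated by \<open>g k\<close> times the norm of \<open>z k\<close>, and
  the Koethe condition bounds the sum of these by the norm of \<open>z\<close>. This glues
  contractive functionals on the summands into one on the lattice sum.\<close>

lemma Esum_functional:
  fixes X :: "nat \<Rightarrow> ('k::real_or_complex, 'v::ab_group_add) nspace"
  assumes E: "banach_sequence_lattice E" and X: "\<And>k. normed_space (X k)"
    and g: "g \<in> koethe_ball E" and h: "\<And>k. h k \<in> dual_ball (X k)"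
  shows Esum_summable: "z \<in> carr (E_sum E X) \<Longrightarrow> summable (\<lambda>k. of_real (g k) * h k (z k))"
    and Esum_dual_ball: "(\<lambda>z. \<Sum>k. of_real (g k) * h k (z k)) \<in> dual_ball (E_sum E X)"
proof -
  have le: "norm (of_real (g k) * h k (z k)) \<le> g k * \<bar>nrm (X k) (z k)\<bar>" if "z \<in> carr (E_sum E X)" for z k
  proof -
    have "norm (h k (z k)) \<le> \<bar>nrm (X k) (z k)\<bar>"
      using dual_ball_bound[OF h, of "z k" k] that by (auto simp: carr_Esum intro: order_trans abs_ge_self)
    then show ?thesis using koethe_ballD(1)[OF g, of k] by (simp add: norm_mult mult_left_mono)
  qed
  have carr: "(\<lambda>k. nrm (X k) (z k)) \<in> carr E" if "z \<in> carr (E_sum E X)" for z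
    using that by (simp add: carr_Esum)
  show s: "summable (\<lambda>k. of_real (g k) * h k (z k))" if z: "z \<in> carr (E_sum E X)" for z
  proof (rule summable_scalar, rule summable_comparison_test')
    show "summable (\<lambda>k. g k * \<bar>nrm (X k) (z k)\<bar>)"
      by (rule koethe_ballD(2)[OF g carr[OF z]])
    show "norm (norm (of_real (g k) * h k (z k))) \<le> g k * \<bar>nrm (X k) (z k)\<bar>" if "k \<ge> 0" for k
      using le[OF z] by simp
  qed
  have hd: "h k \<in> dual (X k)" for k using h by (rule dual_ball_dual)
  show "(\<lambda>z. \<Sum>k. of_real (g k) * h k (z k)) \<in> dual_ball (E_sum E X)"
  proof (rule dual_ballI)
    fix x y assume xy: "x \<in> carr (E_sum E X)" "y \<in> carr (E_sum E X)"
    then have "h k ((x + y) k) = h k (x k) + h k (y k)" for k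
      by (simp add: carr_Esum dual_add[OF X hd])
    then show "(\<Sum>k. of_real (g k) * h k ((x + y) k)) =
        (\<Sum>k. of_real (g k) * h k (x k)) + (\<Sum>k. of_real (g k) * h k (y k))"
      using suminf_add[OF s[OF xy(1)] s[OF xy(2)]] by (simp add: distrib_left)
  next
    fix c x assume x: "x \<in> carr (E_sum E X)"
    then have "h k (scal (E_sum E X) c x k) = c * h k (x k)" for k
      by (simp add: scal_Esum carr_Esum dual_scal[OF X hd])
    then show "(\<Sum>k. of_real (g k) * h k (scal (E_sum E X) c x k)) =
        c * (\<Sum>k. of_real (g k) * h k (x k))"
      using suminf_mult[OF s[OF x], of c] by (simp add: mult.left_commute)
  next
    fix z assume z: "z \<in> carr (E_sum E X)"
    have "norm (\<Sum>k<n. of_real (g k) * h k (z k)) \<le> nrm (E_sum E X) z" for n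
    proof -
      have "norm (\<Sum>k<n. of_real (g k) * h k (z k)) \<le> (\<Sum>k<n. g k * \<bar>nrm (X k) (z k)\<bar>)"
        using le[OF z] by (rule sum_norm_le)
      also have "\<dots> \<le> (\<Sum>k. g k * \<bar>nrm (X k) (z k)\<bar>)"
        using koethe_ballD(1)[OF g] koethe_ballD(2)[OF g carr[OF z]] by (intro sum_le_suminf) auto
      also have "\<dots> \<le> nrm (E_sum E X) z"
        unfolding nrm_Esum by (rule koethe_ballD(3)[OF g carr[OF z]])
      finally show ?thesis .
    qed
    then show "norm (\<Sum>k. of_real (g k) * h k (z k)) \<le> nrm (E_sum E X) z"
      using tendsto_norm[OF summable_LIMSEQ[OF s[OF z]]] by (intro Lim_bounded) auto
  qed
qed

text \<open>Boundedness lets real parts be taken inside convergent series.\<close>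

lemma bounded_linear_re: "bounded_linear re"
  by (rule bounded_linear_intro[where K = 1])
    (simp_all add: re_def[of "scaleR _ _"] complex_of_scalar_scaleR re_add abs_re_le_norm re_def[symmetric])

lemma Esum_functional_re:
  fixes X :: "nat \<Rightarrow> ('k::real_or_complex, 'v::ab_group_add) nspace"
  assumes "banach_sequence_lattice E" "\<And>k. normed_space (X k)"
    "g \<in> koethe_ball E" "\<And>k. h k \<in> dual_ball (X k)" "z \<in> carr (E_sum E X)"
  shows "(\<lambda>k. g k * re (h k (z k))) sums re (\<Sum>k. of_real (g k) * h k (z k))"
  using bounded_linear.sums[OF bounded_linear_re summable_sums[OF Esum_summable[OF assms]]]
  by (simp add: re_of_real_mult)

subsection \<open>Correction of the terms of the series\<close>

text \<open>\<open>\<Phi>\<close> measures how far the functionals \<open>h k\<close> are from attaining their norm on \<open>x\<close>. On the set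
  \<open>K\<close> of coordinates where \<open>h k\<close> almost attains its norm, \<open>x\<close> is replaced by nearby points of the
  faces; by uniform monotonicity the remaining coordinates carry little of the norm, so that there
  arbitrary points of the faces will do.\<close>

lemma Esum_correction:
  fixes X :: "nat \<Rightarrow> ('k::real_or_complex, 'v::ab_group_add) nspace"
  assumes E: "banach_sequence_lattice E" and X: "\<And>k. normed_space (X k)"
    and um: "\<And>u v. \<lbrakk>u \<in> carr E; v \<in> carr E; \<And>n. 0 \<le> u n; \<And>n. 0 \<le> v n;
      nrm E (u + v) \<le> 1; 1 - d \<le> nrm E u\<rbrakk> \<Longrightarrow> nrm E v \<le> \<epsilon>"
    and g: "g \<in> koethe_ball E"
    and b: "b \<in> unit_sphere E" "\<And>k. 0 \<le> b k" "(\<lambda>k. g k * b k) sums 1"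
    and x: "x \<in> unit_sphere (E_sum E X)"
    and ba: "nrm E (b - (\<lambda>k. nrm (X k) (x k))) \<le> \<epsilon>'"
    and h: "\<And>k. h k \<in> dual_ball (X k)"
    and \<Phi>: "(\<lambda>k. g k * (nrm (X k) (x k) - re (h k (x k)))) sums \<Phi>"
    and \<delta>: "0 < \<delta>" and small: "\<epsilon>' + \<Phi> / \<delta> \<le> d" and \<epsilon>: "0 \<le> \<epsilon>"
    and supp: "\<And>k. \<exists>y\<in>unit_sphere (X k). p k y = 1"
    and near: "\<And>k. (1 - \<delta>) * nrm (X k) (x k) < re (h k (x k)) \<Longrightarrow> \<exists>y\<in>unit_sphere (X k). p k y = 1 \<and>
      nrm (X k) (scal (X k) (of_real (nrm (X k) (x k))) y - x k) \<le> \<epsilon> * nrm (X k) (x k)"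
    and p: "\<And>k. p k \<in> dual_ball (X k)"
  shows "\<exists>z\<in>unit_sphere (E_sum E X). nrm (E_sum E X) (z - x) \<le> \<epsilon>' + 3 * \<epsilon> \<and>
    (\<forall>k. p k (z k) = of_real (b k))"
proof -
  note NE = lattice_normed_space[OF E]
  let ?G = "\<lambda>v. \<Sum>k. g k * v k"
  define a where "a = (\<lambda>k. nrm (X k) (x k))"
  have xk: "x k \<in> carr (X k)" for k using x by (simp add: unit_sphere_def carr_Esum)
  have a: "a \<in> carr E" "nrm E a = 1" using x by (auto simp: unit_sphere_def carr_Esum nrm_Esum a_def)
  have a0: "0 \<le> a k" for k unfolding a_def by (rule nrm_nonneg[OF X xk])
  have bc: "b \<in> carr E" "nrm E b = 1" using b(1) by (auto simp: unit_sphere_def)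
  have g0: "0 \<le> g k" for k by (rule koethe_ballD(1)[OF g])
  have GB: "?G \<in> dual_ball E" by (rule koethe_dual_ball[OF E g])
  have Gle: "?G v \<le> nrm E v" if "v \<in> carr E" for v
    using dual_ball_bound[OF GB that] by simp
  define K where "K = {k. (1 - \<delta>) * a k < re (h k (x k))}"
  define u v where "u = restr K a" and "v = restr (- K) a"
  have uv: "u \<in> carr E" "v \<in> carr E" unfolding u_def v_def by (rule lattice_restr[OF E a(1)])+
  have uva: "u + v = a" by (auto simp: u_def v_def restr_def)
  \<comment> \<open>The norm of \<open>u\<close> is at least \<open>?G u\<close>, which is
    \<open>?G a - ?G v\<close>. Here \<open>?G a\<close> is at least \<open>1 - \<epsilon>'\<close>
    because \<open>b\<close> is near and has value 1, and \<open>?G v\<close> is at most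
    \<open>\<Phi> / \<delta>\<close>.\<close>
  have "nrm E v \<le> \<epsilon>"
  proof (rule um[OF uv])
    show "0 \<le> u n" "0 \<le> v n" for n using a0 by (auto simp: u_def v_def restr_def)
    show "nrm E (u + v) \<le> 1" using a uva by simp
    have "\<delta> * ?G v \<le> \<Phi>"
    proof -
      \<comment> \<open>Off \<open>K\<close> the defect of \<open>h k\<close> at \<open>x k\<close>
        is at least \<open>\<delta> * a k\<close>; on \<open>K\<close> the left side is 0 and the
        defect is nonnegative.\<close>
      have le: "\<delta> * (g k * v k) \<le> g k * (a k - re (h k (x k)))" for k
      proof (cases "k \<in> K")
        case True
        have "re (h k (x k)) \<le> a k"
          using dual_ball_bound[OF h xk] re_le_norm[of "h k (x k)"] by (simp add: a_def order_trans)
        then show ?thesis using True g0 by (simp add: v_def restr_def)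
      next
        case False
        then have "\<delta> * a k \<le> a k - re (h k (x k))" by (simp add: K_def algebra_simps)
        then have "g k * (\<delta> * a k) \<le> g k * (a k - re (h k (x k)))" using g0 by (rule mult_left_mono)
        then show ?thesis using False by (simp add: v_def restr_def algebra_simps)
      qed
      have "(\<lambda>k. \<delta> * (g k * v k)) sums (\<delta> * ?G v)"
        by (intro sums_mult summable_sums koethe_summable[OF E g uv(2)])
      from sums_le[OF le[unfolded a_def] this \<Phi>] show ?thesis .
    qed
    then have "?G v \<le> \<Phi> / \<delta>" using \<delta> by (simp add: le_divide_eq mult.commute)
    moreover have "?G a = ?G u + ?G v"
      using dual_add[OF NE dual_ball_dual[OF GB] uv] uva by simp
    moreover have "?G b - ?G a \<le> \<epsilon>'"
      using Gle[OF diff_carr[OF NE bc(1) a(1)]] dual_diff[OF NE dual_ball_dual[OF GB] bc(1) a(1)] ba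
      by (simp add: a_def)
    moreover have "?G b = 1" using b(3) by (simp add: sums_iff)
    ultimately show "1 - d \<le> nrm E u" using Gle[OF uv(1)] small by linarith
  qed
  have "\<exists>y. y \<in> unit_sphere (X k) \<and> p k y = 1 \<and>
      (k \<in> K \<longrightarrow> nrm (X k) (scal (X k) (of_real (a k)) y - x k) \<le> \<epsilon> * a k)" for k
    using supp[of k] near[of k] by (cases "k \<in> K") (auto simp: K_def a_def)
  then obtain y where y: "\<And>k. y k \<in> unit_sphere (X k)" "\<And>k. p k (y k) = 1"
    and yK: "\<And>k. k \<in> K \<Longrightarrow> nrm (X k) (scal (X k) (of_real (a k)) (y k) - x k) \<le> \<epsilon> * a k"
    by metis
  have yc: "y k \<in> carr (X k)" "nrm (X k) (y k) = 1" for k using y(1)[of k] by (auto simp: unit_sphere_def)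
  \<comment> \<open>The length \<open>b k\<close> gives \<open>z\<close> the norm of
    \<open>b\<close>, and makes \<open>p k\<close> take the value \<open>b k\<close>, so that
    summation with the weights \<open>g k\<close> will produce 1.\<close>
  define z where "z = (\<lambda>k. scal (X k) (of_real (b k)) (y k))"
  have zk: "z k \<in> carr (X k)" "nrm (X k) (z k) = b k" for k
    using b(2)[of k] yc by (simp_all add: z_def scal_carr[OF X] nrm_scal[OF X])
  have z: "z \<in> unit_sphere (E_sum E X)"
    using zk bc by (simp add: unit_sphere_def carr_Esum nrm_Esum)
  define q where "q = (\<lambda>k. \<bar>(b - a) k\<bar>)"
  have q: "q \<in> carr E" "nrm E q \<le> \<epsilon>'"
    using lattice_abs[OF E diff_carr[OF NE bc(1) a(1)]] ba by (simp_all add: q_def a_def)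
  \<comment> \<open>The three majorants account for changing the length from \<open>a k\<close> to
    \<open>b k\<close>, for moving to the face on \<open>K\<close>, and for the coordinates off
    \<open>K\<close>, where only \<open>b k + a k \<le> \<bar>b k - a k\<bar> + 2 * a k\<close> is
    available.\<close>
  have "nrm (X k) ((z - x) k) \<le> (q + (scal E \<epsilon> a + scal E 2 v)) k" for k
  proof (cases "k \<in> K")
    case True
    have eq: "(z - x) k = scal (X k) (of_real (b k - a k)) (y k) + (scal (X k) (of_real (a k)) (y k) - x k)"
      by (simp add: z_def scal_diff_left[OF X])
    have "nrm (X k) ((z - x) k) \<le> \<bar>b k - a k\<bar> + \<epsilon> * a k"
      unfolding eq
      using nrm_triangle[OF X scal_carr[OF X yc(1), of k "of_real (b k - a k)"]
          diff_carr[OF X scal_carr[OF X yc(1), of k "of_real (a k)"] xk]] yK[OF True] yc[of k]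
      by (simp add: nrm_scal[OF X] norm_of_real del: of_real_diff)
    then show ?thesis using True by (simp add: q_def v_def restr_def lattice_scal[OF E])
  next
    case False
    have "nrm (X k) ((z - x) k) \<le> b k + a k"
      using nrm_diff_le[OF X zk(1) xk, of k] zk(2) by (simp add: a_def)
    also have "\<dots> \<le> \<bar>b k - a k\<bar> + \<epsilon> * a k + 2 * a k"
      using a0[of k] \<epsilon> mult_nonneg_nonneg[OF \<epsilon> a0[of k]] by linarith
    finally show ?thesis using False by (simp add: q_def v_def restr_def lattice_scal[OF E])
  qed
  then have "nrm (E_sum E X) (z - x) \<le> nrm E (q + (scal E \<epsilon> a + scal E 2 v))"
    using zk xk by (intro Esum_dominated(2)[OF E X]) (auto intro!: diff_carr[OF X] add_carr[OF NE] scal_carr[OF NE] q a uv)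
  also have "\<dots> \<le> nrm E q + (nrm E (scal E \<epsilon> a) + nrm E (scal E 2 v))"
    using nrm_triangle[OF NE q(1) add_carr[OF NE scal_carr[OF NE a(1)] scal_carr[OF NE uv(2)]], of \<epsilon> 2]
      nrm_triangle[OF NE scal_carr[OF NE a(1)] scal_carr[OF NE uv(2)], of \<epsilon> 2] by linarith
  also have "\<dots> \<le> \<epsilon>' + 3 * \<epsilon>"
    using q(2) \<open>nrm E v \<le> \<epsilon>\<close> \<epsilon> a(2) by (simp add: nrm_scal[OF NE a(1)] nrm_scal[OF NE uv(2)])
  finally have "nrm (E_sum E X) (z - x) \<le> \<epsilon>' + 3 * \<epsilon>" .
  moreover have "p k (z k) = of_real (b k)" for k
    using dual_scal[OF X dual_ball_dual[OF p] yc(1)] y(2) by (simp add: z_def)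
  ultimately show ?thesis using z by blast
qed

section \<open>The AHSp condition for the lattice sum\<close>

lemma Esum_AHSp_step:
  fixes E :: "(real, nat \<Rightarrow> real) nspace"
    and X :: "nat \<Rightarrow> ('k::real_or_complex, 'v::ab_group_add) nspace"
  assumes E: "banach_sequence_lattice E" and ah: "AHSp E" and um: "uniformly_monotone E"
    and AX: "\<And>k. AHp_with \<delta> (X k)" and \<epsilon>: "0 < \<epsilon>" "\<epsilon> < 1"
  shows "\<exists>\<eta>. 0 < \<eta> \<and> \<eta> < \<epsilon> \<and>
        (\<forall>x \<alpha> s. range x \<subseteq> unit_sphere (E_sum E X) \<and> convex_series \<alpha> \<and>
            series_sums (E_sum E X) (\<lambda>n. scal (E_sum E X) (of_real (\<alpha> n)) (x n)) s \<and>
            nrm (E_sum E X) s > 1 - \<eta> \<longrightarrow>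
          (\<exists>(A::nat set) z. z ` A \<subseteq> unit_sphere (E_sum E X) \<and>
            (\<Sum>\<^sub>\<infinity>k\<in>A. \<alpha> k) > 1 - \<epsilon> \<and>
            (\<forall>k\<in>A. nrm (E_sum E X) (z k - x k) < \<epsilon>) \<and>
            (\<exists>f\<in>dual_sphere (E_sum E X). \<forall>k\<in>A. f (z k) = 1)))"
proof -
  let ?Z = "E_sum E X"
  have X: "normed_space (X k)" for k using AX[of k] by (simp add: AHp_with_def banach_space_def)
  have BE: "banach_space E" using E by (simp add: banach_sequence_lattice_def)
  note NE = lattice_normed_space[OF E] and NZ = Esum_normed_space[OF E X]
  \<comment> \<open>The final displacement is at most \<open>\<epsilon>' + 3 * \<epsilon>1\<close>,
    which is at most \<open>\<epsilon> / 2\<close>.\<close>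
  define \<epsilon>1 where "\<epsilon>1 = \<epsilon> / 8"
  have \<epsilon>1: "0 < \<epsilon>1" "\<epsilon>1 < 1" using \<epsilon> by (auto simp: \<epsilon>1_def)
  have \<delta>: "0 < \<delta> \<epsilon>1" using AX[of 0] \<epsilon>1 by (auto simp: AHp_with_def)
  obtain d where d: "0 < d" "d < 1" and um_d: "\<And>x y R. \<lbrakk>x \<in> carr E; y \<in> carr E; \<And>n. 0 \<le> x n;
      \<And>n. 0 \<le> y n; 0 < R; nrm E (x + y) \<le> R; (1 - d) * R \<le> nrm E x\<rbrakk> \<Longrightarrow> nrm E y \<le> \<epsilon>1 * R"
    using uniformly_monotone_scaled[OF E um \<epsilon>1(1)] by blast
  \<comment> \<open>The margin \<open>d\<close> of uniform monotonicity is shared: one half for the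
    distance in \<open>E\<close>, the other, through \<mu>, for the defect divided by
    \<open>\<delta> \<epsilon>1\<close>.\<close>
  define \<epsilon>' where "\<epsilon>' = min (\<epsilon> / 8) (d / 2)"
  have \<epsilon>': "0 < \<epsilon>'" "\<epsilon>' < 1" "\<epsilon>' \<le> \<epsilon> / 8" "\<epsilon>' \<le> d / 2" using \<epsilon> d by (auto simp: \<epsilon>'_def)
  define \<mu> where "\<mu> = \<delta> \<epsilon>1 * d / 2"
  have \<mu>: "\<mu> > 0" using \<delta> d by (simp add: \<mu>_def)
  define \<kappa> where "\<kappa> = \<mu> * \<epsilon> / 4"
  have \<kappa>: "\<kappa> > 0" using \<mu> \<epsilon> by (simp add: \<kappa>_def)
  obtain d3 where d3: "0 < d3" "d3 < 1" and um_d3: "\<And>x y R. \<lbrakk>x \<in> carr E; y \<in> carr E; \<And>n. 0 \<le> x n;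
      \<And>n. 0 \<le> y n; 0 < R; nrm E (x + y) \<le> R; (1 - d3) * R \<le> nrm E x\<rbrakk> \<Longrightarrow> nrm E y \<le> \<kappa> / 2 * R"
    using uniformly_monotone_scaled[OF E um, of "\<kappa> / 2"] \<kappa> by auto
  obtain \<eta>E where \<eta>E: "0 < \<eta>E" "\<eta>E < \<epsilon>'" and HE: "\<forall>a \<alpha> t.
      (\<forall>n. a n \<in> unit_sphere E) \<and> (\<forall>n k. 0 \<le> a n k) \<and> convex_series \<alpha> \<and>
        series_sums E (\<lambda>n. scal E (\<alpha> n) (a n)) t \<and> 1 - \<eta>E < nrm E t \<longrightarrow>
      (\<exists>A b g. (\<forall>n\<in>A. b n \<in> unit_sphere E \<and> (\<forall>k. 0 \<le> b n k) \<and> nrm E (b n - a n) < \<epsilon>' \<and>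
          (\<lambda>k. g k * b n k) sums 1) \<and>
        (\<Sum>\<^sub>\<infinity>n\<in>A. \<alpha> n) > 1 - \<epsilon>' \<and> g \<in> koethe_ball E)"
    using lattice_AHSp_positive[OF E ah um \<epsilon>'(1,2)] by blast
  \<comment> \<open>The bound \<open>\<eta>E\<close> makes the AHSp of \<open>E\<close> applicable
    to the norm sequences, and \<open>d3\<close> makes uniform monotonicity applicable to the norm
    sequence of \<open>s\<close>.\<close>
  define \<eta> where "\<eta> = min \<eta>E d3"
  have \<eta>: "0 < \<eta>" "\<eta> < \<epsilon>" "\<eta> \<le> \<eta>E" "\<eta> \<le> d3" using \<eta>E d3 \<epsilon>' \<epsilon> by (auto simp: \<eta>_def)
  have "\<exists>(A::nat set) z. z ` A \<subseteq> unit_sphere ?Z \<and> (\<Sum>\<^sub>\<infinity>k\<in>A. \<alpha> k) > 1 - \<epsilon> \<and>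
            (\<forall>k\<in>A. nrm ?Z (z k - x k) < \<epsilon>) \<and> (\<exists>f\<in>dual_sphere ?Z. \<forall>k\<in>A. f (z k) = 1)"
    if xr: "range x \<subseteq> unit_sphere ?Z" and \<alpha>: "convex_series \<alpha>"
      and s: "series_sums ?Z (\<lambda>n. scal ?Z (of_real (\<alpha> n)) (x n)) s" and s1: "nrm ?Z s > 1 - \<eta>"
    for x \<alpha> s
  proof -
    have \<alpha>0: "0 \<le> \<alpha> n" for n using \<alpha> by (simp add: convex_series_def)
    have x: "x n \<in> unit_sphere ?Z" for n using xr by auto
    have xZ: "x n \<in> carr ?Z" for n using x[of n] by (simp add: unit_sphere_def)
    have xk: "x n k \<in> carr (X k)" for n k using xZ[of n] by (simp add: carr_Esum)
    have sZ: "s \<in> carr ?Z" using s by (simp add: series_sums_def)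
    have sk: "s k \<in> carr (X k)" for k using sZ by (simp add: carr_Esum)
    define a \<sigma> where "a n = (\<lambda>k. nrm (X k) (x n k))" and "\<sigma> = (\<lambda>k. nrm (X k) (s k))" for n
    have a: "a n \<in> unit_sphere E" for n
      using x[of n] by (simp add: unit_sphere_def carr_Esum nrm_Esum a_def)
    have ac: "a n \<in> carr E" "nrm E (a n) = 1" for n using a[of n] by (auto simp: unit_sphere_def)
    have a0: "0 \<le> a n k" for n k unfolding a_def by (rule nrm_nonneg[OF X xk])
    have \<sigma>: "\<sigma> \<in> carr E" "nrm E \<sigma> = nrm ?Z s" using sZ by (simp_all add: carr_Esum nrm_Esum \<sigma>_def)
    have \<sigma>0: "0 \<le> \<sigma> k" for k unfolding \<sigma>_def by (rule nrm_nonneg[OF X sk])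
    have \<alpha>ac: "scal E (\<alpha> n) (a n) \<in> carr E" for n by (rule scal_carr[OF NE ac(1)])
    \<comment> \<open>Convergence is given only for the vectors \<open>x n\<close>; for their norm
      sequences it follows from absolute convergence in the Banach space \<open>E\<close>.\<close>
    obtain t where t: "series_sums E (\<lambda>n. scal E (\<alpha> n) (a n)) t"
    proof (rule banach_absolutely_convergent[OF BE \<alpha>ac])
      show "summable (\<lambda>n. nrm E (scal E (\<alpha> n) (a n)))"
        using \<alpha> by (simp add: nrm_scal[OF NE ac(1)] ac(2) convex_series_def sums_iff)
    qed
    have tc: "t \<in> carr E" using t by (simp add: series_sums_def)
    have t1: "nrm E t \<le> 1" using nrm_convex_series_le[OF NE \<alpha> a] t by simp
    \<comment> \<open>The triangle inequality for the partial sums in \<open>X k\<close>, passed to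
      the limit on both sides.\<close>
    have \<sigma>t: "\<sigma> k \<le> t k" for k
    proof -
      define P where "P n = (\<Sum>i<n. scal ?Z (of_real (\<alpha> i)) (x i))" for n
      have P: "P n \<in> carr ?Z" for n
        unfolding P_def by (intro sum_carr[OF NZ] scal_carr[OF NZ] xZ)
      have Pk: "P n k = (\<Sum>i<n. scal (X k) (of_real (\<alpha> i)) (x i k))" for n
        by (simp add: P_def sum_fun_apply scal_Esum)
      have Pc: "P n k \<in> carr (X k)" for n using P[of n] by (simp add: carr_Esum)
      obtain C where C: "\<And>x. x \<in> carr ?Z \<Longrightarrow> nrm (X k) (x k) \<le> C * nrm ?Z x"
        using Esum_coordinate_bound[where E = E and X = X and k = k, OF E X] by blast
      have "(\<lambda>n. C * nrm ?Z (P n - s)) \<longlonglongrightarrow> 0"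
        using s by (intro tendsto_mult_right_zero) (simp add: series_sums_def P_def)
      moreover have "norm (nrm (X k) (P n k - s k)) \<le> C * nrm ?Z (P n - s)" for n
        using C[OF diff_carr[OF NZ P sZ]] nrm_nonneg[OF X diff_carr[OF X Pc sk]] by simp
      ultimately have "(\<lambda>n. nrm (X k) (P n k - s k)) \<longlonglongrightarrow> 0"
        by (intro Lim_null_comparison[of "\<lambda>n. nrm (X k) (P n k - s k)"]) auto
      then have lim1: "(\<lambda>n. nrm (X k) (P n k)) \<longlonglongrightarrow> \<sigma> k"
        unfolding \<sigma>_def by (rule tendsto_nrm[OF X Pc sk])
      have "(\<lambda>n. (\<Sum>i<n. scal E (\<alpha> i) (a i)) k) \<longlonglongrightarrow> t k"
        using t \<alpha>ac by (intro lattice_tendsto_coordinate[OF E _ tc]) (auto simp: series_sums_def intro: sum_carr[OF NE])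
      then have lim2: "(\<lambda>n. \<Sum>i<n. \<alpha> i * a i k) \<longlonglongrightarrow> t k"
        by (simp add: sum_fun_apply lattice_scal[OF E])
      have "nrm (X k) (P n k) \<le> (\<Sum>i<n. \<alpha> i * a i k)" for n
        using nrm_sum_le[OF X, of "{..<n}" "\<lambda>i. scal (X k) (of_real (\<alpha> i)) (x i k)" k] \<alpha>0
        by (simp add: Pk nrm_scal[OF X xk] scal_carr[OF X xk] a_def)
      then show ?thesis using LIMSEQ_le[OF lim1 lim2] by blast
    qed
    have \<sigma>_le: "nrm E \<sigma> \<le> nrm E t"
      by (rule lattice_solid(2)[OF E tc]) (use \<sigma>0 order_trans[OF \<sigma>t abs_ge_self] in auto)
    have tE: "1 - \<eta>E < nrm E t" using s1 \<sigma>_le \<sigma>(2) \<eta>(3) by linarith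
    have t\<sigma>: "t - \<sigma> \<in> carr E" by (rule diff_carr[OF NE tc \<sigma>(1)])
    \<comment> \<open>Both summands of \<open>t = \<sigma> + (t - \<sigma>)\<close> are nonnegative,
      the sum has norm at most 1, and \<sigma> already has norm above \<open>1 - d3\<close>.\<close>
    have t\<sigma>_le: "nrm E (t - \<sigma>) \<le> \<kappa> / 2"
      using um_d3[of \<sigma> "t - \<sigma>" 1] \<sigma> t\<sigma> \<sigma>0 \<sigma>t t1 s1 \<eta>(4) by simp
    have "(\<forall>n. a n \<in> unit_sphere E) \<and> (\<forall>n k. 0 \<le> a n k) \<and> convex_series \<alpha> \<and>
        series_sums E (\<lambda>n. scal E (\<alpha> n) (a n)) t \<and> 1 - \<eta>E < nrm E t"
      using a a0 \<alpha> t tE by simp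
    from HE[THEN spec, THEN spec, THEN spec, THEN mp, OF this]
    obtain A b g where Ab: "\<forall>n\<in>A. b n \<in> unit_sphere E \<and> (\<forall>k. 0 \<le> b n k) \<and>
        nrm E (b n - a n) < \<epsilon>' \<and> (\<lambda>k. g k * b n k) sums 1"
      and A: "(\<Sum>\<^sub>\<infinity>n\<in>A. \<alpha> n) > 1 - \<epsilon>'" and g: "g \<in> koethe_ball E"
      by blast
    have b: "b n \<in> unit_sphere E" "0 \<le> b n k" "nrm E (b n - a n) < \<epsilon>'" "(\<lambda>k. g k * b n k) sums 1"
      if "n \<in> A" for n k
      using Ab that by simp_all
    \<comment> \<open>The functionals are chosen from \<open>s k\<close>, independently of
      \<open>n\<close>, so that the same \<open>p k\<close> serves every term of the series.\<close>
    have "\<exists>h p. h \<in> dual_ball (X k) \<and> p \<in> dual_ball (X k) \<and> (1 - \<kappa> / 2) * \<sigma> k \<le> re (h (s k)) \<and>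
      (\<exists>y\<in>unit_sphere (X k). p y = 1) \<and>
      (\<forall>x\<in>carr (X k). (1 - \<delta> \<epsilon>1) * nrm (X k) x < re (h x) \<longrightarrow> (\<exists>y\<in>unit_sphere (X k). p y = 1 \<and>
        nrm (X k) (scal (X k) (of_real (nrm (X k) x)) y - x) \<le> \<epsilon>1 * nrm (X k) x))" for k
    proof -
      have "1 - \<kappa> / 2 < 1" using \<kappa> by simp
      from AHp_support[OF AX \<epsilon>1 this sk[of k]] show ?thesis
        unfolding \<sigma>_def by metis
    qed
    then obtain h p where h: "\<And>k. h k \<in> dual_ball (X k)" and p: "\<And>k. p k \<in> dual_ball (X k)"
      and hs: "\<And>k. (1 - \<kappa> / 2) * \<sigma> k \<le> re (h k (s k))"
      and supp: "\<And>k. \<exists>y\<in>unit_sphere (X k). p k y = 1"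
      and near: "\<And>k x. x \<in> carr (X k) \<Longrightarrow> (1 - \<delta> \<epsilon>1) * nrm (X k) x < re (h k x) \<Longrightarrow>
        \<exists>y\<in>unit_sphere (X k). p k y = 1 \<and>
        nrm (X k) (scal (X k) (of_real (nrm (X k) x)) y - x) \<le> \<epsilon>1 * nrm (X k) x"
      by metis
    define G where "G v = (\<Sum>k. g k * v k)" for v
    define F where "F z = (\<Sum>k. of_real (g k) * h k (z k))" for z
    have G: "G \<in> dual_ball E" unfolding G_def[abs_def] by (rule koethe_dual_ball[OF E g])
    have F: "F \<in> dual_ball ?Z" unfolding F_def[abs_def] by (rule Esum_dual_ball[OF E X g h])
    \<comment> \<open>The defect of \<open>x n\<close>: by \<open>gap\<close> it is the weighted sum
      of the coordinate defects, hence nonnegative.\<close>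
    define \<Phi> where "\<Phi> n = G (a n) - re (F (x n))" for n
    have gap: "(\<lambda>k. g k * (nrm (X k) (z k) - re (h k (z k)))) sums (G (\<lambda>k. nrm (X k) (z k)) - re (F z))"
      if z: "z \<in> carr ?Z" for z
    proof -
      have "(\<lambda>k. g k * nrm (X k) (z k)) sums G (\<lambda>k. nrm (X k) (z k))"
        unfolding G_def using z by (intro summable_sums koethe_summable[OF E g]) (simp add: carr_Esum)
      from sums_diff[OF this Esum_functional_re[OF E X g h z]] show ?thesis
        by (simp add: F_def right_diff_distrib)
    qed
    have \<Phi>_sums: "(\<lambda>k. g k * (nrm (X k) (x n k) - re (h k (x n k)))) sums \<Phi> n" for n
      using gap[OF xZ] by (simp add: \<Phi>_def a_def)
    have \<Phi>0: "0 \<le> \<Phi> n" for n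
    proof (rule sums_le[OF _ sums_zero \<Phi>_sums])
      fix k
      have "re (h k (x n k)) \<le> nrm (X k) (x n k)"
        using dual_ball_bound[OF h xk] re_le_norm order_trans by blast
      then show "0 \<le> g k * (nrm (X k) (x n k) - re (h k (x n k)))"
        using koethe_ballD(1)[OF g] by simp
    qed
    have total: "(\<lambda>n. \<alpha> n * \<Phi> n) sums (G t - re (F s))"
    proof -
      have 1: "(\<lambda>n. \<alpha> n * G (a n)) sums G t"
        using dual_ball_series[OF NE G \<alpha>ac t] by (simp add: dual_scal[OF NE dual_ball_dual[OF G] ac(1)])
      have "(\<lambda>n. of_real (\<alpha> n) * F (x n)) sums F s"
        using dual_ball_series[OF NZ F scal_carr[OF NZ xZ] s]
        by (simp add: dual_scal[OF NZ dual_ball_dual[OF F] xZ])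
      then have "(\<lambda>n. \<alpha> n * re (F (x n))) sums re (F s)"
        using bounded_linear.sums[OF bounded_linear_re] by (fastforce simp: re_of_real_mult)
      from sums_diff[OF 1 this] show ?thesis by (simp add: \<Phi>_def right_diff_distrib)
    qed
    \<comment> \<open>One half of \<kappa> pays for replacing \<open>t\<close> by \<sigma>, the
      other for \<open>h k\<close> being only almost norming at \<open>s k\<close>, since
      \<open>G \<sigma>\<close> is at most 1.\<close>
    have "G t - re (F s) \<le> \<kappa>"
    proof -
      have "G t - G \<sigma> \<le> \<kappa> / 2"
        using dual_ball_bound[OF G t\<sigma>] dual_diff[OF NE dual_ball_dual[OF G] tc \<sigma>(1)] t\<sigma>_le by simp
      moreover have "G \<sigma> - re (F s) \<le> \<kappa> / 2 * G \<sigma>"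
      proof (rule sums_le[OF _ gap[OF sZ, folded \<sigma>_def]])
        show "g k * (nrm (X k) (s k) - re (h k (s k))) \<le> \<kappa> / 2 * (g k * \<sigma> k)" for k
        proof -
          have "nrm (X k) (s k) - re (h k (s k)) \<le> \<kappa> / 2 * \<sigma> k"
            using hs[of k] by (simp add: \<sigma>_def algebra_simps)
          then have "g k * (nrm (X k) (s k) - re (h k (s k))) \<le> g k * (\<kappa> / 2 * \<sigma> k)"
            using koethe_ballD(1)[OF g] by (rule mult_left_mono)
          then show ?thesis by (simp add: mult.left_commute)
        qed
        show "(\<lambda>k. \<kappa> / 2 * (g k * \<sigma> k)) sums (\<kappa> / 2 * G \<sigma>)"
          unfolding G_def by (intro sums_mult summable_sums koethe_summable[OF E g \<sigma>(1)])
      qed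
      moreover have "\<kappa> / 2 * G \<sigma> \<le> \<kappa> / 2 * 1"
        using dual_ball_bound[OF G \<sigma>(1)] \<sigma>_le t1 \<kappa> by (intro mult_left_mono) auto
      ultimately show ?thesis by linarith
    qed
    then have partial: "(\<Sum>n<N. \<alpha> n * \<Phi> n) \<le> \<kappa>" for N
      using total \<alpha>0 \<Phi>0 sum_le_suminf[of "\<lambda>n. \<alpha> n * \<Phi> n" "{..<N}"]
      by (auto simp: sums_iff)
    define B where "B = A \<inter> {n. \<Phi> n \<le> \<mu>}"
    \<comment> \<open>The weight lost is below \<open>\<epsilon>' + \<epsilon> / 4\<close>, where
      \<open>\<epsilon>'\<close> is at most \<open>\<epsilon> / 8\<close>.\<close>
    have "\<kappa> / \<mu> = \<epsilon> / 4" using \<mu> by (simp add: \<kappa>_def)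
    then have B: "(\<Sum>\<^sub>\<infinity>n\<in>B. \<alpha> n) > 1 - \<epsilon>"
      using convex_series_markov[OF \<alpha> \<Phi>0 partial \<mu>, of A] A \<epsilon>'(3) \<epsilon>(1) unfolding B_def by linarith
    have "\<exists>z\<in>unit_sphere ?Z. nrm ?Z (z - x n) \<le> \<epsilon>' + 3 * \<epsilon>1 \<and> (\<forall>k. p k (z k) = of_real (b n k))"
      if n: "n \<in> B" for n
    proof (rule Esum_correction[OF E X _ g b(1) b(2) b(4) x _ h \<Phi>_sums \<delta> _ _ supp near[OF xk] p])
      show "n \<in> A" "n \<in> A" "n \<in> A" using n by (simp_all add: B_def)
      show "nrm E v \<le> \<epsilon>1" if "u \<in> carr E" "v \<in> carr E" "\<And>n. 0 \<le> u n" "\<And>n. 0 \<le> v n"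
        "nrm E (u + v) \<le> 1" "1 - d \<le> nrm E u" for u v
        using um_d[of u v 1] that by simp
      show "nrm E (b n - (\<lambda>k. nrm (X k) (x n k))) \<le> \<epsilon>'"
        using b(3)[of n] n by (simp add: B_def a_def)
      have "\<Phi> n \<le> d / 2 * \<delta> \<epsilon>1" using n by (simp add: B_def \<mu>_def mult.commute)
      then have "\<Phi> n / \<delta> \<epsilon>1 \<le> d / 2" using \<delta> by (simp only: pos_divide_le_eq)
      then show "\<epsilon>' + \<Phi> n / \<delta> \<epsilon>1 \<le> d" using \<epsilon>'(4) by linarith
      show "0 \<le> \<epsilon>1" using \<epsilon>1 by simp
    qed
    then obtain z where z: "\<And>n. n \<in> B \<Longrightarrow> z n \<in> unit_sphere ?Z"
        "\<And>n. n \<in> B \<Longrightarrow> nrm ?Z (z n - x n) \<le> \<epsilon>' + 3 * \<epsilon>1"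
        "\<And>n k. n \<in> B \<Longrightarrow> p k (z n k) = of_real (b n k)"
      by metis
    define f where "f z = (\<Sum>k. of_real (g k) * p k (z k))" for z
    have f: "f \<in> dual_ball ?Z" unfolding f_def[abs_def] by (rule Esum_dual_ball[OF E X g p])
    have fz: "f (z n) = 1" if n: "n \<in> B" for n
    proof -
      have "(\<lambda>k. of_real (g k * b n k) :: 'k) sums of_real 1"
        using b(4)[of n] n by (intro sums_of_real) (simp add: B_def)
      then show ?thesis by (simp add: f_def z(3)[OF n] sums_iff)
    qed
    \<comment> \<open>The weight of \<open>B\<close> is positive, so there is some
      \<open>z n\<close> at which \<open>f\<close> attains the value 1 and thereby lies on the dual
      sphere.\<close>
    have "B \<noteq> {}" using B \<epsilon> by auto
    then have "f \<in> dual_sphere ?Z"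
      using dual_sphereI[OF NZ dual_ball_dual[OF f] dual_ball_bound[OF f]] z(1) fz by blast
    moreover have "nrm ?Z (z n - x n) < \<epsilon>" if "n \<in> B" for n
      using z(2)[OF that] \<epsilon>'(3) \<epsilon>(1) by (simp add: \<epsilon>1_def)
    ultimately show ?thesis using z(1) fz B by (intro exI[of _ B] exI[of _ z]) auto
  qed
  with \<eta>(1,2) show ?thesis by blast
qed

theorem theorem2p10:
  fixes E :: "(real, nat \<Rightarrow> real) nspace"
    and X :: "nat \<Rightarrow> ('k::real_or_complex, 'v::ab_group_add) nspace"
  assumes "banach_sequence_lattice E"
    and "AHSp E"
    and "uniformly_monotone E"
    and "\<And>k. banach_space (X k)"
    and "AHp_uniformly X"
  shows "AHSp (E_sum E X)"
proof -
  obtain \<delta> where "\<And>k. AHp_with \<delta> (X k)" using assms(5) by (auto simp: AHp_uniformly_def)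
  from Esum_AHSp_step[OF assms(1-3) this] Esum_banach_space[of E X, OF assms(1,4)] show ?thesis
    unfolding AHSp_def by (intro conjI allI impI) auto
qed

end
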